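(* Let $A$ be a $C^*$-algebra and let $Q=\{q\in A\mid\sigma(q)=\{0\}\}$ be the set of its quasinilpotent elements. If a derivation $d$ of $A$ satisfies $d(Q)\subseteq Q$, then $d=0$.
   Context: $C^*$-algebras are complex and not necessarily unital. $\sigma(a)$ denotes the spectrum of $a\in A$ (computed in the unitization when $A$ has no identity element). A derivation of $A$ is a linear map $d:A\to A$ with $d(xy)=d(x)y+xd(y)$ for all $x,y\in A$; it is not assumed to be continuous or to preserve the involution. *)

theory Defs
  imports Complex_Main
begin

text \<open>
  A C*-algebra is a type of class \<open>cstar_algebra\<close>. The class extends the class
  \<open>real_normed_algebra\<close>, not \<open>real_normed_algebra_1\<close>: there is no unit in the signature, an
  identity element may or may not exist, and the zero algebra is allowed.
\<close>

class cstar_algebra = real_normed_algebra + banach +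
  fixes scaleC :: "complex \<Rightarrow> 'a \<Rightarrow> 'a"  (infixr \<open>*\<^sub>C\<close> 75)
    and star :: "'a \<Rightarrow> 'a"
  assumes scaleC_add_right: "c *\<^sub>C (x + y) = c *\<^sub>C x + c *\<^sub>C y"
    and scaleC_add_left: "(b + c) *\<^sub>C x = b *\<^sub>C x + c *\<^sub>C x"
    and scaleC_scaleC: "b *\<^sub>C c *\<^sub>C x = (b * c) *\<^sub>C x"
    and scaleR_scaleC: "r *\<^sub>R x = complex_of_real r *\<^sub>C x"
    and mult_scaleC_left: "(c *\<^sub>C x) * y = c *\<^sub>C (x * y)"
    and mult_scaleC_right: "x * (c *\<^sub>C y) = c *\<^sub>C (x * y)"
    and norm_scaleC: "norm (c *\<^sub>C x) = cmod c * norm x"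
    and star_add: "star (x + y) = star x + star y"
    and star_scaleC: "star (c *\<^sub>C x) = cnj c *\<^sub>C star x"
    and star_mult: "star (x * y) = star y * star x"
    and star_star: "star (star x) = x"
    and cstar_identity: "norm (star x * x) = (norm x)\<^sup>2"

lemma vector_space_scaleC: "vector_space (scaleC :: complex \<Rightarrow> 'a::cstar_algebra \<Rightarrow> 'a)"
proof
  fix x :: 'a
  show "1 *\<^sub>C x = x"
    using scaleR_scaleC[of 1 x] by simp
qed (simp_all add: scaleC_add_right scaleC_add_left scaleC_scaleC)

instantiation complex :: cstar_algebra
begin

definition scaleC_complex :: "complex \<Rightarrow> complex \<Rightarrow> complex" where
  "scaleC_complex = (*)"

definition star_complex :: "complex \<Rightarrow> complex" where
  "star_complex = cnj"

instance
  by standard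
    (simp_all add: scaleC_complex_def star_complex_def algebra_simps scaleR_conv_of_real
      norm_mult power2_eq_square)

end

definition is_identity :: "'a::cstar_algebra \<Rightarrow> bool" where
  "is_identity e \<longleftrightarrow> (\<forall>x. e * x = x \<and> x * e = x)"

text \<open>
  The pair \<open>(a, s)\<close> stands for the element \<open>a + s1\<close> of the unitization, whose identity
  element is \<open>(0, 1)\<close>.
\<close>

definition unitization_mult ::
  "'a::cstar_algebra \<times> complex \<Rightarrow> 'a \<times> complex \<Rightarrow> 'a \<times> complex" where
  "unitization_mult x y =
     (fst x * fst y + snd x *\<^sub>C fst y + snd y *\<^sub>C fst x, snd x * snd y)"

definition invertible_wrt :: "('b \<Rightarrow> 'b \<Rightarrow> 'b) \<Rightarrow> 'b \<Rightarrow> 'b \<Rightarrow> bool" where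
  "invertible_wrt m e x \<longleftrightarrow> (\<exists>y. m x y = e \<and> m y x = e)"

text \<open>
  The identity element \<open>e\<close> in the first branch is unique; \<open>(- a, c)\<close> in the second branch is
  \<open>c1 - a\<close>. In the zero algebra the spectrum of \<open>0\<close> is empty.
\<close>

definition alg_spectrum :: "'a::cstar_algebra \<Rightarrow> complex set" where
  "alg_spectrum a =
     (if \<exists>e::'a. is_identity e
      then {c. \<exists>e. is_identity e \<and> \<not> invertible_wrt (*) e (c *\<^sub>C e - a)}
      else {c. \<not> invertible_wrt unitization_mult (0, 1) (- a, c)})"

definition quasinilpotents :: "'a::cstar_algebra set" where
  "quasinilpotents = {q. alg_spectrum q = {0}}"

definition derivation :: "('a::cstar_algebra \<Rightarrow> 'a) \<Rightarrow> bool" where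
  "derivation d \<longleftrightarrow>
     Vector_Spaces.linear scaleC scaleC d \<and> (\<forall>x y. d (x * y) = d x * y + x * d y)"

end

theory Submission
  imports Defs "HOL-Analysis.Analysis" "HOL-Computational_Algebra.Fundamental_Theorem_Algebra"
begin

text \<open>
  The derivation is controlled through square-zero elements. Let \<open>x\<^sup>2 = 0\<close> and \<open>y = d(x)\<close>. For every
  \<open>a\<close> the element \<open>x a x\<close> has square zero, so \<open>d(x a x)\<close> is quasinilpotent, and a computation with
  2 by 2 matrices turns this into one-sided invertibility of \<open>r - a x y\<close> for all \<open>r \<noteq> 0\<close>. For
  \<open>a = (x y)\<^sup>*\<close> this forces \<open>x y = 0\<close> (lemma \<open>square_zero_mult_D_self\<close>). From here on the argument is
  algebraic: conjugation by the invertible elements \<open>1 + t a\<close>, differentiation at \<open>t = 0\<close> and the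
  semiprimeness of C*-algebras give \<open>x d(a) x = 0\<close>, then \<open>d(x) = 0\<close>, then \<open>[d(a), x] = 0\<close>, and
  finally \<open>x b d(c) = 0\<close> for all \<open>b\<close>, \<open>c\<close> (lemma \<open>square_zero_mult_ideal\<close>).

  So square-zero elements annihilate the ideal generated by the range of \<open>d\<close>. A closed ideal
  without nonzero square-zero elements is commutative, and derivations of commutative C*-algebras
  vanish, because a function that vanishes at a point is a product of two such functions. The
  proof carries out both steps at once for a self-adjoint \<open>h\<close>, without representations or
  characters. If \<open>g f = 0\<close>, then \<open>f d(c) y g = 0\<close> for all \<open>c\<close>, \<open>y\<close> (lemma \<open>orthogonal_sandwich\<close>).
  Near a point \<open>r\<close> one factors \<open>h - r\<close> into two functions of \<open>h\<close> that are both small near \<open>r\<close>, so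
  the product rule makes \<open>d(h)\<close> small near \<open>r\<close> (lemma \<open>D_locally_small\<close>). A partition of unity adds
  these local estimates up; the pieces are orthogonal, so that their number does not matter
  (lemma \<open>D_selfadjoint\<close>).

  All of this takes place in the unitization, to which the derivation extends by \<open>d(1) = 0\<close>. The
  analytic tools, namely that \<open>norm s\<close> or \<open>- norm s\<close> lies in the spectrum of a self-adjoint \<open>s\<close>
  and the continuous functional calculus, rest on one inequality: \<open>norm (1 - 2 g\<^sup>2) \<le> 1\<close> for
  self-adjoint \<open>g\<close> with \<open>norm g \<le> 1\<close>.
\<close>

class unital_cstar_algebra = cstar_algebra + real_normed_algebra_1


section \<open>Elementary consequences of the C*-identity\<close>

lemma scaleC_0_left [simp]: "0 *\<^sub>C x = (0::'a::cstar_algebra)"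
  using scaleC_add_left[of 0 0 x] by simp

lemma scaleC_0_right [simp]: "c *\<^sub>C (0::'a::cstar_algebra) = 0"
  using scaleC_add_right[of c 0 0] by simp

lemma scaleC_1 [simp]: "1 *\<^sub>C x = (x::'a::cstar_algebra)"
  using scaleR_scaleC[of 1 x] by simp

lemma scaleC_minus_left: "(- c) *\<^sub>C x = - (c *\<^sub>C (x::'a::cstar_algebra))"
  using scaleC_add_left[of "- c" c x] by (simp add: eq_neg_iff_add_eq_0)

lemma scaleC_minus_right: "c *\<^sub>C (- x) = - (c *\<^sub>C (x::'a::cstar_algebra))"
  using scaleC_add_right[of c "- x" x] by (simp add: eq_neg_iff_add_eq_0)

lemma scaleC_diff_right: "c *\<^sub>C (x - y) = c *\<^sub>C x - c *\<^sub>C (y::'a::cstar_algebra)"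
  using scaleC_add_right[of c x "- y"] by (simp add: scaleC_minus_right)

lemma star_0 [simp]: "star (0::'a::cstar_algebra) = 0"
  using star_add[of "0::'a" 0] by simp

lemma star_minus: "star (- x) = - star (x::'a::cstar_algebra)"
  using star_add[of "- x" x] by (simp add: eq_neg_iff_add_eq_0)

lemma star_diff: "star (x - y) = star x - star (y::'a::cstar_algebra)"
  using star_add[of x "- y"] by (simp add: star_minus)

lemma star_scaleR: "star (r *\<^sub>R x) = r *\<^sub>R star (x::'a::cstar_algebra)"
  by (simp add: scaleR_scaleC star_scaleC)

lemma star_sum: "star (sum f A) = (\<Sum>i\<in>A. star (f i :: 'a::cstar_algebra))"
  by (induction A rule: infinite_finite_induct) (simp_all add: star_add)

lemma norm_star [simp]: "norm (star x) = norm (x::'a::cstar_algebra)"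
proof -
  have le: "norm y \<le> norm (star y)" for y :: 'a
  proof (cases "norm y = 0")
    case False
    have "norm y * norm y \<le> norm (star y) * norm y"
      using norm_mult_ineq[of "star y" y] by (simp add: cstar_identity power2_eq_square)
    then show ?thesis
      using False by (simp add: mult_le_cancel_right)
  qed simp
  show ?thesis
    using le[of x] le[of "star x"] by (simp add: star_star)
qed

lemma bounded_linear_star: "bounded_linear (star :: 'a::cstar_algebra \<Rightarrow> 'a)"
  by (rule bounded_linear_intro[where K = 1]) (simp_all add: star_add star_scaleR)

lemma star_mult_self_eq_0: "star x * x = 0 \<Longrightarrow> x = (0::'a::cstar_algebra)"
  using cstar_identity[of x] by simp

lemma mult_star_self_eq_0: "x * star x = 0 \<Longrightarrow> x = (0::'a::cstar_algebra)"
  using star_mult_self_eq_0[of "star x"] by (metis star_star star_0)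

lemma star_1 [simp]: "star 1 = (1::'a::unital_cstar_algebra)"
  by (metis mult_1_left mult_1_right star_mult star_star)

text \<open>
  The relations \<open>x x\<^sup>* x z = 0\<close> that come out of the algebra below may be shortened, because
  \<open>(x\<^sup>* x z)\<^sup>* (x\<^sup>* x z)\<close> and then \<open>(x z)\<^sup>* (x z)\<close> vanish.
\<close>

lemma cancel_star_left:
  fixes x z :: "'a::cstar_algebra"
  assumes "x * star x * x * z = 0"
  shows "x * z = 0"
proof -
  have "star (star x * x * z) * (star x * x * z) = star z * star x * (x * star x * x * z)"
    by (simp add: star_mult star_star mult.assoc)
  then have "star x * x * z = 0"
    using assms star_mult_self_eq_0 by fastforce
  then have "star (x * z) * (x * z) = 0"
    by (simp add: star_mult mult.assoc)
  then show ?thesis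
    by (rule star_mult_self_eq_0)
qed

lemma semiprime:
  fixes x :: "'a::cstar_algebra"
  assumes "\<And>b. x * b * x = 0"
  shows "x = 0"
proof -
  have "x * star x * x * star x = 0"
    using assms[of "star x"] by simp
  then show ?thesis
    by (metis cancel_star_left mult_star_self_eq_0)
qed

lemma star_power:
  "star (s ^ n) = star (s::'a::unital_cstar_algebra) ^ n"
  by (induction n) (simp_all add: star_mult power_commutes)


section \<open>Square roots by the binomial series\<close>

text \<open>
  The power series coefficients of \<open>sqrt (1 - x)\<close>.
\<close>

definition sqrt_coeff :: "nat \<Rightarrow> real" where
  "sqrt_coeff n = ((1/2) gchoose n) * (-1) ^ n"

lemma sqrt_coeff_0 [simp]: "sqrt_coeff 0 = 1"
  by (simp add: sqrt_coeff_def)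

lemma sqrt_coeff_Suc:
  "sqrt_coeff (Suc n) = sqrt_coeff n * ((real n - 1/2) / real (Suc n))"
proof -
  have "((1/2::real) gchoose Suc n) = ((1/2) gchoose n) * ((1/2 - real n) / real (Suc n))"
    using gbinomial_mult_1[of "1/2::real" n] by (simp add: field_simps)
  also have "(1/2 - real n) / real (Suc n) = - ((real n - 1/2) / real (Suc n))"
    by (metis minus_diff_eq minus_divide_left)
  finally show ?thesis
    unfolding sqrt_coeff_def power_Suc by (simp only: mult_minus_left mult_minus_right mult_1 mult_ac minus_minus)
qed

lemma sqrt_coeff_Suc_nonpos: "sqrt_coeff (Suc n) \<le> 0"
proof (induction n)
  case 0
  show ?case by (simp add: sqrt_coeff_Suc)
next
  case (Suc n)
  have "0 \<le> (real (Suc n) - 1/2) / real (Suc (Suc n))"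
    by simp
  then show ?case
    using Suc mult_nonpos_nonneg by (subst sqrt_coeff_Suc) blast
qed

lemma sqrt_coeff_sums:
  fixes x :: real
  assumes "\<bar>x\<bar> < 1"
  shows "(\<lambda>n. sqrt_coeff n * x ^ n) sums sqrt (1 - x)"
  using gen_binomial_real[of "- x" "1/2"] assms
  by (simp add: sqrt_coeff_def powr_half_sqrt power_minus[of x] mult_ac)

text \<open>
  The series converges absolutely up to the boundary of the disc: all coefficients but the
  zeroth are nonpositive, and for \<open>0 \<le> x < 1\<close> their sum against \<open>x\<^sup>n\<close> is
  \<open>sqrt (1 - x) - 1 \<ge> - 1\<close>.
\<close>

lemma summable_abs_sqrt_coeff: "summable (\<lambda>n. \<bar>sqrt_coeff n\<bar>)"
proof -
  have partial: "(\<Sum>n<N. \<bar>sqrt_coeff (Suc n)\<bar> * x ^ Suc n) \<le> 1" if "0 < x" "x < 1" for N and x :: real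
  proof -
    have "(\<lambda>n. sqrt_coeff (Suc n) * x ^ Suc n) sums (sqrt (1 - x) - 1)"
      using sqrt_coeff_sums[of x] that by (subst sums_Suc_iff) simp
    then have "(\<lambda>n. - (sqrt_coeff (Suc n) * x ^ Suc n)) sums (- (sqrt (1 - x) - 1))"
      by (rule sums_minus)
    then have s: "(\<lambda>n. \<bar>sqrt_coeff (Suc n)\<bar> * x ^ Suc n) sums (1 - sqrt (1 - x))"
      by (simp add: abs_of_nonpos[OF sqrt_coeff_Suc_nonpos])
    have "(\<Sum>n<N. \<bar>sqrt_coeff (Suc n)\<bar> * x ^ Suc n) \<le> 1 - sqrt (1 - x)"
      unfolding sums_unique[OF s] using that s
      by (intro sum_le_suminf) (auto simp: sums_iff)
    also have "\<dots> \<le> 1"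
      using that by simp
    finally show ?thesis .
  qed
  have "(\<Sum>n<N. \<bar>sqrt_coeff (Suc n)\<bar>) \<le> 1" for N
  proof (rule tendsto_upperbound)
    show "((\<lambda>x. \<Sum>n<N. \<bar>sqrt_coeff (Suc n)\<bar> * x ^ Suc n) \<longlongrightarrow> (\<Sum>n<N. \<bar>sqrt_coeff (Suc n)\<bar>)) (at_left 1)"
      by (auto intro!: tendsto_eq_intros)
    show "\<forall>\<^sub>F x in at_left 1. (\<Sum>n<N. \<bar>sqrt_coeff (Suc n)\<bar> * x ^ Suc n) \<le> 1"
      using eventually_at_left_real[of 0 "1::real"] partial
      by (auto elim!: eventually_mono)
  qed simp
  then have "summable (\<lambda>n. \<bar>sqrt_coeff (Suc n)\<bar>)"
    by (intro summableI_nonneg_bounded[where x = 1]) auto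
  then show ?thesis
    by (subst (asm) summable_Suc_iff)
qed

text \<open>
  Vandermonde's identity for the exponent \<open>1/2 + 1/2 = 1\<close>: the square of the series for
  \<open>sqrt (1 - x)\<close> is \<open>1 - x\<close> as a formal power series.
\<close>

lemma sqrt_coeff_convolution:
  "(\<Sum>i\<le>n. sqrt_coeff i * sqrt_coeff (n - i)) = (if n = 0 then 1 else if n = 1 then -1 else 0)"
proof -
  have "(\<Sum>i\<le>n. sqrt_coeff i * sqrt_coeff (n - i))
      = (\<Sum>i\<le>n. ((1/2) gchoose i) * ((1/2) gchoose (n - i))) * (-1) ^ n"
    unfolding sum_distrib_right
    by (intro sum.cong refl) (simp add: sqrt_coeff_def flip: power_add)
  also have "\<dots> = ((1::real) gchoose n) * (-1) ^ n"
    using gbinomial_Vandermonde[of "1/2::real" "1/2" n] by (simp add: atLeast0AtMost)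
  also have "((1::real) gchoose n) = of_nat (1 choose n)"
    using binomial_gbinomial[of 1 n, where 'a = real] by simp
  finally show ?thesis
    by (cases n) (auto simp: binomial_eq_0)
qed

definition sqrt_one_minus :: "'a \<Rightarrow> 'a::unital_cstar_algebra" where
  "sqrt_one_minus y = (\<Sum>n. sqrt_coeff n *\<^sub>R y ^ n)"

lemma summable_norm_sqrt_one_minus:
  fixes y :: "'a::unital_cstar_algebra"
  assumes "norm y \<le> 1"
  shows "summable (\<lambda>n. norm (sqrt_coeff n *\<^sub>R y ^ n))"
proof (rule summable_comparison_test'[OF summable_abs_sqrt_coeff, of 0])
  fix n
  have "norm (y ^ n) \<le> 1"
    using norm_power_ineq[of y n] assms power_le_one[of "norm y" n] by simp
  then show "norm (norm (sqrt_coeff n *\<^sub>R y ^ n)) \<le> \<bar>sqrt_coeff n\<bar>"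
    by (simp add: mult_left_le)
qed

lemma sqrt_one_minus_square:
  fixes y :: "'a::unital_cstar_algebra"
  assumes "norm y \<le> 1"
  shows "sqrt_one_minus y * sqrt_one_minus y = 1 - y"
proof -
  have "(\<Sum>i\<le>n. (sqrt_coeff i *\<^sub>R y ^ i) * (sqrt_coeff (n - i) *\<^sub>R y ^ (n - i)))
      = (\<Sum>i\<le>n. sqrt_coeff i * sqrt_coeff (n - i)) *\<^sub>R y ^ n" for n
    unfolding scaleR_sum_left by (intro sum.cong refl) (simp flip: power_add)
  then have "sqrt_one_minus y * sqrt_one_minus y
      = (\<Sum>n. (if n = 0 then 1 else if n = 1 then -1 else 0) *\<^sub>R y ^ n)"
    unfolding sqrt_one_minus_def
      Cauchy_product[OF summable_norm_sqrt_one_minus[OF assms] summable_norm_sqrt_one_minus[OF assms]]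
    by (simp only: sqrt_coeff_convolution)
  also have "\<dots> = (\<Sum>n\<in>{0, 1}. (if n = 0 then 1 else if n = 1 then -1 else 0) *\<^sub>R y ^ n)"
    by (rule suminf_finite) auto
  finally show ?thesis
    by simp
qed

lemma sqrt_one_minus_selfadjoint:
  fixes y :: "'a::unital_cstar_algebra"
  assumes "norm y \<le> 1" "star y = y"
  shows "star (sqrt_one_minus y) = sqrt_one_minus y"
  unfolding sqrt_one_minus_def
    bounded_linear.suminf[OF bounded_linear_star
      summable_norm_cancel[OF summable_norm_sqrt_one_minus[OF assms(1)]]]
  by (simp add: star_scaleR star_power assms(2))

lemma sqrt_one_minus_commute:
  fixes y :: "'a::unital_cstar_algebra"
  assumes "norm y \<le> 1" "y * b = b * y"
  shows "sqrt_one_minus y * b = b * sqrt_one_minus y"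
proof -
  have summ: "summable (\<lambda>n. sqrt_coeff n *\<^sub>R y ^ n)"
    using summable_norm_cancel[OF summable_norm_sqrt_one_minus[OF assms(1)]] .
  have "y ^ n * b = b * y ^ n" for n
    using assms(2) by (metis power_commuting_commutes)
  then show ?thesis
    unfolding sqrt_one_minus_def suminf_mult[OF summ, symmetric] suminf_mult2[OF summ]
    by simp
qed


section \<open>The spectrum of a self-adjoint element\<close>

text \<open>
  With \<open>g = cos \<theta>\<close> the assertion is \<open>\<bar>cos (2 \<theta>)\<bar> \<le> 1\<close>: the element
  \<open>u = g + \<i> sqrt (1 - g\<^sup>2)\<close>, which plays the role of \<open>exp (\<i> \<theta>)\<close>, is unitary and hence of
  norm one, and \<open>1 - 2 g\<^sup>2\<close> is \<open>- (u\<^sup>2 + u\<^sup>*\<^sup>2) / 2\<close>. This estimate replaces the theory of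
  positive elements throughout.
\<close>

lemma norm_one_minus_two_square_le:
  fixes g :: "'a::unital_cstar_algebra"
  assumes "star g = g" "norm g \<le> 1"
  shows "norm (1 - 2 *\<^sub>R (g * g)) \<le> 1"
proof -
  define w where "w = sqrt_one_minus (g * g)"
  have gg: "norm (g * g) \<le> 1" "star (g * g) = g * g"
    using norm_mult_ineq[of g g] mult_le_one[of "norm g" "norm g"] assms
    by (auto simp: star_mult)
  have ww: "w * w = 1 - g * g" and sw: "star w = w" and wg: "w * g = g * w"
    using gg sqrt_one_minus_square sqrt_one_minus_selfadjoint sqrt_one_minus_commute[of "g * g" g]
    by (auto simp: w_def mult.assoc)
  define u where "u = g + \<i> *\<^sub>C w"
  have su: "star u = g - \<i> *\<^sub>C w"
    by (simp add: u_def star_add star_scaleC assms(1) sw scaleC_minus_left)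
  have "star u * u = 1"
    unfolding su unfolding u_def
    by (simp add: algebra_simps mult_scaleC_left mult_scaleC_right scaleC_scaleC wg ww
        scaleC_minus_left scaleC_diff_right scaleC_add_right)
  then have nu: "norm u = 1"
    using cstar_identity[of u] by (simp add: power2_eq_1_iff) (metis abs_norm_cancel abs_neg_one power2_eq_1_iff)
  have "u * u = (g * g - w * w) + (\<i> *\<^sub>C (g * w) + \<i> *\<^sub>C (g * w))"
    "star u * star u = (g * g - w * w) - (\<i> *\<^sub>C (g * w) + \<i> *\<^sub>C (g * w))"
    unfolding su unfolding u_def
    by (simp_all add: algebra_simps mult_scaleC_left mult_scaleC_right scaleC_scaleC wg
        scaleC_minus_left scaleC_diff_right scaleC_add_right)
  then have "u * u + star u * star u = (g * g - w * w) + (g * g - w * w)"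
    by simp
  then have "(1/2) *\<^sub>R (u * u + star u * star u) = g * g - w * w"
    by (simp only: scaleR_half_double)
  then have "1 - 2 *\<^sub>R (g * g) = - ((1/2) *\<^sub>R (u * u + star u * star u))"
    by (simp add: ww scaleR_2)
  also have "norm \<dots> \<le> (1/2) * (norm (u * u) + norm (star u * star u))"
    using norm_triangle_ineq[of "u * u" "star u * star u"] by simp
  also have "\<dots> \<le> 1"
    using norm_mult_ineq[of u u] norm_mult_ineq[of "star u" "star u"] nu by simp
  finally show ?thesis .
qed

lemma norm_one_minus_square_le:
  fixes g :: "'a::unital_cstar_algebra"
  assumes "star g = g" "norm g \<le> 1"
  shows "norm (1 - g * g) \<le> 1"
proof -
  have "1 - g * g = (1/2) *\<^sub>R 1 + (1/2) *\<^sub>R (1 - 2 *\<^sub>R (g * g))"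
    by (simp add: scaleR_diff_right add_diff_eq flip: scaleR_add_left)
  then show ?thesis
    using norm_one_minus_two_square_le[OF assms]
      norm_triangle_ineq[of "(1/2) *\<^sub>R 1" "(1/2) *\<^sub>R (1 - 2 *\<^sub>R (g * g))"]
    by simp
qed

lemma norm_square_defect_le:
  fixes k :: "'a::unital_cstar_algebra"
  assumes "star k = k"
  shows "norm ((norm k)\<^sup>2 *\<^sub>R 1 - k * k) \<le> (norm k)\<^sup>2"
proof (cases "k = 0")
  case False
  define g where "g = (1 / norm k) *\<^sub>R k"
  have "k * k = (norm k)\<^sup>2 *\<^sub>R (g * g)"
    using False by (simp add: g_def power2_eq_square)
  then have "(norm k)\<^sup>2 *\<^sub>R 1 - k * k = (norm k)\<^sup>2 *\<^sub>R (1 - g * g)"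
    by (simp add: algebra_simps)
  moreover have "norm (1 - g * g) \<le> 1"
    using False by (intro norm_one_minus_square_le) (auto simp: g_def star_scaleR assms)
  ultimately show ?thesis
    by (simp add: mult_left_le)
qed simp

lemma invertible_mult:
  fixes x y :: "'a::unital_cstar_algebra"
  assumes "invertible_wrt (*) 1 x" "invertible_wrt (*) 1 y"
  shows "invertible_wrt (*) 1 (x * y)"
  using assms unfolding invertible_wrt_def by (metis mult.assoc mult_1_left)

lemma invertible_if_left_right:
  fixes x :: "'a::unital_cstar_algebra"
  assumes "a * x = 1" "x * b = 1"
  shows "invertible_wrt (*) 1 x"
  using assms unfolding invertible_wrt_def by (metis mult.assoc mult_1_left mult_1_right)

lemma invertible_factor:
  fixes x y :: "'a::unital_cstar_algebra"
  assumes "invertible_wrt (*) 1 (x * y)" "x * y = y * x"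
  shows "invertible_wrt (*) 1 x"
  using assms invertible_if_left_right unfolding invertible_wrt_def by (metis mult.assoc)

lemma invertible_scaleR:
  fixes x :: "'a::unital_cstar_algebra"
  assumes "r \<noteq> 0" "invertible_wrt (*) 1 x"
  shows "invertible_wrt (*) 1 (r *\<^sub>R x)"
proof -
  obtain y where "x * y = 1" "y * x = 1"
    using assms(2) by (auto simp: invertible_wrt_def)
  then show ?thesis
    using assms(1) by (intro invertible_if_left_right[of "(1/r) *\<^sub>R y" _ "(1/r) *\<^sub>R y"]) simp_all
qed

lemma invertible_one_minus:
  fixes y :: "'a::unital_cstar_algebra"
  assumes "norm y < 1"
  shows "invertible_wrt (*) 1 (1 - y)"
proof -
  have s: "summable (\<lambda>n. y ^ n)"
    using assms by (rule complete_algebra_summable_geometric)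
  define z where "z = (\<Sum>n. y ^ n)"
  have "(\<Sum>n. y ^ Suc n) = z - 1"
    unfolding z_def using suminf_split_head[OF s] by simp
  moreover have "(\<Sum>n. y ^ Suc n) = y * z" "(\<Sum>n. y ^ Suc n) = z * y"
    unfolding z_def suminf_mult[OF s, symmetric] suminf_mult2[OF s] by (simp_all add: power_commutes)
  ultimately show ?thesis
    by (intro invertible_if_left_right[of z _ z]) (simp_all add: algebra_simps)
qed

text \<open>
  If \<open>q\<close> inverts \<open>1 - s\<^sup>2\<close>, then \<open>1 - (1 + t) s\<^sup>2 = (1 - s\<^sup>2) (1 + t - t q)\<close> still has a self-adjoint
  square root \<open>k\<close> for some \<open>t > 0\<close>. The estimates above give \<open>norm k \<le> 1\<close> and then
  \<open>norm (1 - k\<^sup>2) \<le> 1\<close>, although \<open>1 - k\<^sup>2 = (1 + t) s\<^sup>2\<close> has norm \<open>1 + t\<close>.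
\<close>

lemma one_minus_square_not_invertible:
  fixes s :: "'a::unital_cstar_algebra"
  assumes s: "star s = s" "norm s = 1"
  shows "\<not> invertible_wrt (*) 1 (1 - s * s)"
proof
  assume "invertible_wrt (*) 1 (1 - s * s)"
  then obtain q where q: "(1 - s * s) * q = 1" "q * (1 - s * s) = 1"
    by (auto simp: invertible_wrt_def)
  have nss: "norm (s * s) = 1"
    using cstar_identity[of s] s by simp
  have "star q * (1 - s * s) = star ((1 - s * s) * q)"
    by (simp add: star_mult star_diff s)
  then have "star q * (1 - s * s) * q = q"
    using q by simp
  then have sq: "star q = q"
    using q by (simp add: mult.assoc)
  define t where "t = 1 / (1 + norm q)"
  have t: "0 < t" "t \<le> 1" "t * (1 + norm q) = 1"
    by (auto simp: t_def add_pos_nonneg divide_simps)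
       (smt (verit) norm_ge_zero)
  define y where "y = t *\<^sub>R (q - 1)"
  have "t * norm (q - 1) \<le> t * (1 + norm q)"
    using norm_triangle_ineq4[of q 1] t by (intro mult_left_mono) auto
  then have y: "norm y \<le> 1" "star y = y"
    using t by (auto simp: y_def star_scaleR star_diff sq)
  define w where "w = sqrt_one_minus (s * s)"
  define v where "v = sqrt_one_minus y"
  have "s * s * y = y * (s * s)"
  proof -
    have "s * s * q = q - 1" "q * (s * s) = q - 1"
      using q by (simp_all add: algebra_simps)
    then show ?thesis
      by (simp add: y_def right_diff_distrib left_diff_distrib)
  qed
  then have "w * y = y * w"
    using nss by (simp add: w_def sqrt_one_minus_commute)
  then have vw: "v * w = w * v"
    using y by (simp add: v_def sqrt_one_minus_commute)
  have ww: "w * w = 1 - s * s" and sw: "star w = w"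
    using nss s by (simp_all add: w_def sqrt_one_minus_square sqrt_one_minus_selfadjoint star_mult)
  have vv: "v * v = 1 - y" and sv: "star v = v"
    using y by (simp_all add: v_def sqrt_one_minus_square sqrt_one_minus_selfadjoint)
  define k where "k = w * v"
  have sk: "star k = k"
    by (simp add: k_def star_mult sw sv vw)
  have "k * k = (w * w) * (v * v)"
    unfolding k_def by (metis mult.assoc vw)
  also have "\<dots> = (1 - s * s) - t *\<^sub>R ((1 - s * s) * q) + t *\<^sub>R (1 - s * s)"
    by (simp add: ww vv y_def algebra_simps)
  also have "\<dots> = 1 - (1 + t) *\<^sub>R (s * s)"
    unfolding q by (simp add: algebra_simps)
  finally have kk: "k * k = 1 - (1 + t) *\<^sub>R (s * s)" .
  define g where "g = sqrt ((1 + t) / 2) *\<^sub>R s"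
  have "sqrt ((1 + t) / 2) \<le> 1"
    using t by simp
  then have g: "star g = g" "norm g \<le> 1"
    using t s by (auto simp: g_def star_scaleR)
  have "2 *\<^sub>R (g * g) = (1 + t) *\<^sub>R (s * s)"
    using t by (simp add: g_def)
  then have "norm (k * k) \<le> 1"
    using norm_one_minus_two_square_le[OF g] kk by simp
  then have "(norm k)\<^sup>2 \<le> 1"
    using cstar_identity[of k] sk by simp
  then have "norm (1 - k * k) \<le> 1"
    using sk norm_one_minus_square_le power2_le_imp_le[of "norm k" 1] by simp
  then show False
    using nss t unfolding kk by simp
qed

text \<open>
  For self-adjoint \<open>s\<close> one of \<open>norm s\<close> and \<open>- norm s\<close> belongs to the spectrum. The product
  of \<open>norm s - s\<close> and \<open>norm s + s\<close> leaves open which.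
\<close>

lemma norm_square_minus_square_not_invertible:
  fixes s :: "'a::unital_cstar_algebra"
  assumes s: "star s = s" "s \<noteq> 0"
  shows "\<not> invertible_wrt (*) 1 ((norm s)\<^sup>2 *\<^sub>R 1 - s * s)"
proof
  define g where "g = (1 / norm s) *\<^sub>R s"
  assume "invertible_wrt (*) 1 ((norm s)\<^sup>2 *\<^sub>R 1 - s * s)"
  then have "invertible_wrt (*) 1 ((1 / (norm s)\<^sup>2) *\<^sub>R ((norm s)\<^sup>2 *\<^sub>R 1 - s * s))"
    using s by (intro invertible_scaleR) auto
  also have "(1 / (norm s)\<^sup>2) *\<^sub>R ((norm s)\<^sup>2 *\<^sub>R 1 - s * s) = 1 - g * g"
    using s by (simp add: g_def algebra_simps power2_eq_square)
  finally show False
    using one_minus_square_not_invertible[of g] s by (simp add: g_def star_scaleR)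
qed

text \<open>
  The spectrum of \<open>h\<close> lies in \<open>[- norm h, norm h]\<close>. Off the real axis this holds because, for
  \<open>k = h - Re c\<close>, the product of \<open>c - h\<close> and \<open>cnj c - h\<close> is \<open>k\<^sup>2 + (Im c)\<^sup>2\<close>, a small perturbation
  of the scalar \<open>(norm k)\<^sup>2 + (Im c)\<^sup>2\<close>.
\<close>

lemma invertible_outside_interval:
  fixes h :: "'a::unital_cstar_algebra"
  assumes h: "star h = h" and c: "\<And>t. \<bar>t\<bar> \<le> norm h \<Longrightarrow> c \<noteq> of_real t"
  shows "invertible_wrt (*) 1 (c *\<^sub>C 1 - h)"
proof (cases "Im c = 0")
  case True
  then have "c = of_real (Re c)"
    by (simp add: complex_eq_iff)
  then have r: "norm h < \<bar>Re c\<bar>" "c *\<^sub>C 1 = Re c *\<^sub>R (1::'a)"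
    using c[of "Re c"] by (auto simp: scaleR_scaleC simp flip: not_le)
  then have "Re c \<noteq> 0"
    using norm_ge_zero[of h] by linarith
  have "invertible_wrt (*) 1 (1 - (1 / Re c) *\<^sub>R h)"
    using r
    by (intro invertible_one_minus) (auto simp: divide_simps)
  then have "invertible_wrt (*) 1 (Re c *\<^sub>R (1 - (1 / Re c) *\<^sub>R h))"
    using \<open>Re c \<noteq> 0\<close> by (intro invertible_scaleR)
  then show ?thesis
    using r \<open>Re c \<noteq> 0\<close> by (simp add: algebra_simps)
next
  case False
  define k where "k = h - Re c *\<^sub>R 1"
  define L where "L = (norm k)\<^sup>2 + (Im c)\<^sup>2"
  have L: "L > 0" "(norm k)\<^sup>2 < L"
    using False by (auto simp: L_def add_nonneg_pos)
  have sk: "star k = k"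
    by (simp add: k_def star_diff star_scaleR h)
  have "norm ((1 / L) *\<^sub>R ((norm k)\<^sup>2 *\<^sub>R 1 - k * k)) < 1"
    using norm_square_defect_le[OF sk] L by (auto simp: divide_simps)
  then have inv: "invertible_wrt (*) 1 (L *\<^sub>R (1 - (1 / L) *\<^sub>R ((norm k)\<^sup>2 *\<^sub>R 1 - k * k)))"
    using L by (intro invertible_scaleR invertible_one_minus) auto
  define z where "z = \<i> * complex_of_real (Im c)"
  have z: "of_real (Re c) + z = c" "of_real (Re c) + - z = cnj c"
    by (simp_all add: z_def complex_eq_iff)
  have "(of_real (Re c) + z) *\<^sub>C (1::'a) = Re c *\<^sub>R 1 + z *\<^sub>C 1"
    "(of_real (Re c) + - z) *\<^sub>C (1::'a) = Re c *\<^sub>R 1 + - (z *\<^sub>C 1)"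
    by (simp_all only: scaleC_add_left scaleC_minus_left scaleR_scaleC)
  then have c1: "c *\<^sub>C 1 - h = z *\<^sub>C 1 - k" "cnj c *\<^sub>C 1 - h = - (z *\<^sub>C 1) - k"
    unfolding z by (simp_all add: k_def)
  have "z * z = - of_real ((Im c)\<^sup>2)"
    by (simp add: z_def complex_eq_iff power2_eq_square)
  then have "(Im c)\<^sup>2 *\<^sub>R (1::'a) = - ((z * z) *\<^sub>C 1)"
    by (simp add: scaleR_scaleC scaleC_minus_left)
  then have prods: "(c *\<^sub>C 1 - h) * (cnj c *\<^sub>C 1 - h) = (Im c)\<^sup>2 *\<^sub>R 1 + k * k"
       "(cnj c *\<^sub>C 1 - h) * (c *\<^sub>C 1 - h) = (Im c)\<^sup>2 *\<^sub>R 1 + k * k"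
    unfolding c1
    by (simp_all add: algebra_simps mult_scaleC_left mult_scaleC_right scaleC_scaleC
        scaleC_minus_right scaleC_diff_right)
  have "L *\<^sub>R (1 - (1 / L) *\<^sub>R ((norm k)\<^sup>2 *\<^sub>R 1 - k * k)) = (Im c)\<^sup>2 *\<^sub>R 1 + k * k"
    using L by (simp add: algebra_simps) (simp add: L_def algebra_simps)
  then show ?thesis
    using inv invertible_factor[of "c *\<^sub>C 1 - h" "cnj c *\<^sub>C 1 - h"] prods by simp
qed


section \<open>The continuous functional calculus of a self-adjoint element\<close>

text \<open>
  Polynomials with complex coefficients, because the invertibility of \<open>p(h)\<close> is read off from the
  factorization of \<open>p\<close> into linear factors. The calculus itself uses those with real coefficients,
  whose values at a self-adjoint element are self-adjoint.
\<close>

definition poly_at :: "'a::unital_cstar_algebra \<Rightarrow> complex poly \<Rightarrow> 'a" where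
  "poly_at h p = fold_coeffs (\<lambda>c x. c *\<^sub>C 1 + h * x) p 0"

lemma poly_at_0 [simp]: "poly_at h 0 = 0"
  by (simp add: poly_at_def)

lemma poly_at_pCons [simp]: "poly_at h (pCons c p) = c *\<^sub>C 1 + h * poly_at h p"
  by (cases "c = 0 \<and> p = 0") (auto simp: poly_at_def)

lemma poly_at_add: "poly_at h (p + q) = poly_at h p + poly_at h q"
proof (induction p arbitrary: q rule: pCons_induct)
  case (pCons c p)
  show ?case
    by (cases q) (simp add: pCons scaleC_add_left distrib_left add.assoc add.left_commute)
qed simp

lemma poly_at_smult: "poly_at h (smult c p) = c *\<^sub>C poly_at h p"
  by (induction p rule: pCons_induct)
    (simp_all add: scaleC_scaleC scaleC_add_right mult_scaleC_right)

lemma poly_at_diff: "poly_at h (p - q) = poly_at h p - poly_at h q"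
  using poly_at_add[of h p "smult (- 1) q"] poly_at_smult[of h "- 1" q]
  by (simp add: scaleC_minus_left)

lemma poly_at_mult: "poly_at h (p * q) = poly_at h p * poly_at h q"
  by (induction p rule: pCons_induct)
    (simp_all add: mult_pCons_left poly_at_add poly_at_smult algebra_simps mult_scaleC_left)

lemma poly_at_commute: "poly_at h p * h = h * poly_at h p"
  by (induction p rule: pCons_induct)
    (simp_all add: algebra_simps mult_scaleC_left mult_scaleC_right)

definition real_coeffs :: "complex poly \<Rightarrow> bool" where
  "real_coeffs p \<longleftrightarrow> (\<forall>i. coeff p i \<in> \<real>)"

lemma real_coeffs_pCons: "real_coeffs (pCons c p) \<longleftrightarrow> c \<in> \<real> \<and> real_coeffs p"
  unfolding real_coeffs_def by (metis coeff_pCons_0 coeff_pCons_Suc not0_implies_Suc)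

lemma real_coeffs_add: "real_coeffs p \<Longrightarrow> real_coeffs q \<Longrightarrow> real_coeffs (p + q)"
  by (simp add: real_coeffs_def)

lemma real_coeffs_diff: "real_coeffs p \<Longrightarrow> real_coeffs q \<Longrightarrow> real_coeffs (p - q)"
  by (simp add: real_coeffs_def)

lemma real_coeffs_mult: "real_coeffs p \<Longrightarrow> real_coeffs q \<Longrightarrow> real_coeffs (p * q)"
  by (auto simp: real_coeffs_def coeff_mult)

lemma poly_at_selfadjoint:
  assumes "star h = h" "real_coeffs p"
  shows "star (poly_at h p) = poly_at h p"
  using assms(2)
proof (induction p rule: pCons_induct)
  case (pCons c p)
  then show ?case
    by (auto simp: real_coeffs_pCons star_add star_scaleC star_mult assms(1) poly_at_commute
        Reals_cnj_iff)
qed simp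

text \<open>
  Each linear factor of \<open>p\<close> takes an invertible value at \<open>h\<close>, its root being outside
  \<open>[- norm h, norm h]\<close>.
\<close>

lemma poly_at_invertible:
  fixes h :: "'a::unital_cstar_algebra"
  assumes h: "star h = h"
    and "\<And>t. \<bar>t\<bar> \<le> norm h \<Longrightarrow> poly p (of_real t) \<noteq> 0"
  shows "invertible_wrt (*) 1 (poly_at h p)"
  using assms(2)
proof (induction "degree p" arbitrary: p)
  case 0
  then obtain c where p: "p = [:c:]"
    by (metis degree_eq_zeroE)
  then have "c \<noteq> 0"
    using "0.prems"[of 0] by simp
  then show ?case
    unfolding p
    by (intro invertible_if_left_right[of "inverse c *\<^sub>C 1" _ "inverse c *\<^sub>C 1"])
      (simp_all add: mult_scaleC_left mult_scaleC_right scaleC_scaleC)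
next
  case (Suc n)
  then have "\<not> constant (poly p)"
    by (simp add: constant_degree)
  then obtain z where z: "poly p z = 0"
    using fundamental_theorem_of_algebra by blast
  then obtain q where q: "p = [:- z, 1:] * q"
    using poly_eq_0_iff_dvd by (metis dvd_def)
  then have "q \<noteq> 0"
    using Suc by auto
  have "degree p = Suc (degree q)"
    unfolding q using \<open>q \<noteq> 0\<close> by (subst degree_mult_eq) auto
  moreover have "poly q (of_real t) \<noteq> 0" if "\<bar>t\<bar> \<le> norm h" for t
    using Suc.prems[OF that] by (simp add: q)
  ultimately have iq: "invertible_wrt (*) 1 (poly_at h q)"
    using Suc by simp
  have "z \<noteq> of_real t" if "\<bar>t\<bar> \<le> norm h" for t
    using Suc.prems[OF that] z by auto
  then have "invertible_wrt (*) 1 ((- 1) *\<^sub>R (z *\<^sub>C 1 - h))"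
    by (intro invertible_scaleR invertible_outside_interval h) auto
  also have "(- 1) *\<^sub>R (z *\<^sub>C 1 - h) = poly_at h [:- z, 1:]"
    by (simp add: scaleC_minus_left)
  finally show ?case
    using iq by (simp only: q poly_at_mult invertible_mult)
qed

text \<open>
  The element \<open>c\<^sup>2 - s\<^sup>2\<close> for \<open>s = p(h)\<close> and \<open>c = norm s\<close> is not invertible, so
  \<open>c\<^sup>2 - p\<^sup>2\<close> has a root in \<open>[- norm h, norm h]\<close>.
\<close>

lemma norm_poly_at_le:
  fixes h :: "'a::unital_cstar_algebra"
  assumes h: "star h = h" and p: "real_coeffs p"
    and B: "\<And>t. \<bar>t\<bar> \<le> norm h \<Longrightarrow> cmod (poly p (of_real t)) \<le> B"
  shows "norm (poly_at h p) \<le> B"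
proof (rule ccontr)
  assume "\<not> norm (poly_at h p) \<le> B"
  define s where "s = poly_at h p"
  define P where "P = [: of_real ((norm s)\<^sup>2) :] - p * p"
  have c: "B < norm s"
    using \<open>\<not> norm (poly_at h p) \<le> B\<close> by (simp add: s_def)
  have "0 \<le> B"
    using order_trans[OF norm_ge_zero B[of 0]] by simp
  have "poly P (of_real t) \<noteq> 0" if "\<bar>t\<bar> \<le> norm h" for t
  proof
    assume "poly P (of_real t) = 0"
    then have "of_real ((norm s)\<^sup>2) = poly p (of_real t) * poly p (of_real t)"
      by (simp add: P_def)
    then have "cmod (of_real ((norm s)\<^sup>2)) = (cmod (poly p (of_real t)))\<^sup>2"
      by (simp add: norm_mult power2_eq_square)
    also have "\<dots> \<le> B\<^sup>2"
      using B[OF that] by (intro power_mono) auto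
    also have "\<dots> < (norm s)\<^sup>2"
      using c \<open>0 \<le> B\<close> by (intro power_strict_mono) auto
    finally show False
      by (simp del: of_real_power)
  qed
  then have "invertible_wrt (*) 1 (poly_at h P)"
    by (rule poly_at_invertible[OF h])
  also have "poly_at h P = (norm s)\<^sup>2 *\<^sub>R 1 - s * s"
    by (simp add: P_def poly_at_diff poly_at_mult s_def scaleR_scaleC)
  finally have "invertible_wrt (*) 1 ((norm s)\<^sup>2 *\<^sub>R 1 - s * s)" .
  moreover have "star s = s" "s \<noteq> 0"
    using poly_at_selfadjoint[OF h p] c \<open>0 \<le> B\<close> by (auto simp: s_def)
  ultimately show False
    using norm_square_minus_square_not_invertible by blast
qed

lemma real_poly_approx:
  fixes f :: "real \<Rightarrow> real"
  assumes "continuous_on {- M..M} f" "e > 0"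
  obtains p where "real_coeffs p" "\<And>t. \<bar>t\<bar> \<le> M \<Longrightarrow> cmod (poly p (of_real t) - of_real (f t)) < e"
proof -
  obtain g where "real_polynomial_function g" and g: "\<And>t. t \<in> {- M..M} \<Longrightarrow> \<bar>f t - g t\<bar> < e"
    using Stone_Weierstrass_real_polynomial_function[OF compact_Icc assms] by blast
  then obtain a n where a: "g = (\<lambda>t. \<Sum>i\<le>n. a i * t ^ i)"
    unfolding real_polynomial_function_iff_sum by blast
  define p where "p = (\<Sum>i\<le>n. monom (complex_of_real (a i)) i)"
  have p: "poly p (of_real t) = of_real (g t)" for t
    by (simp add: p_def a poly_sum poly_monom)
  show thesis
  proof (rule that)
    show "real_coeffs p"
      by (auto simp: real_coeffs_def p_def coeff_sum)
    fix t :: real assume "\<bar>t\<bar> \<le> M"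
    then have "t \<in> {- M..M}"
      by (simp add: abs_le_iff)
    then have "\<bar>g t - f t\<bar> < e"
      using g by (simp add: abs_minus_commute)
    then show "cmod (poly p (of_real t) - of_real (f t)) < e"
      unfolding p by (simp flip: of_real_diff)
  qed
qed

text \<open>
  Simultaneous approximation of \<open>f\<close> on \<open>[- norm h, norm h]\<close> and of \<open>a\<close> by the same polynomial. With
  a relation in place of a limit along a chosen sequence, sums and products are obtained from sums
  and products of approximating polynomials.
\<close>

definition has_cfc :: "'a::unital_cstar_algebra \<Rightarrow> (real \<Rightarrow> real) \<Rightarrow> 'a \<Rightarrow> bool" where
  "has_cfc h f a \<longleftrightarrow> (\<forall>e>0. \<exists>p. real_coeffs p \<and>
     (\<forall>t. \<bar>t\<bar> \<le> norm h \<longrightarrow> cmod (poly p (of_real t) - of_real (f t)) < e) \<and> norm (poly_at h p - a) < e)"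

lemma has_cfcE:
  assumes "has_cfc h f a" "e > 0"
  obtains p where "real_coeffs p" "norm (poly_at h p - a) < e"
    "\<And>t. \<bar>t\<bar> \<le> norm h \<Longrightarrow> cmod (poly p (of_real t) - of_real (f t)) < e"
  using assms unfolding has_cfc_def by blast

lemma has_cfc_poly:
  assumes "real_coeffs p" "\<And>t. \<bar>t\<bar> \<le> norm h \<Longrightarrow> poly p (of_real t) = of_real (f t)"
  shows "has_cfc h f (poly_at h p)"
  unfolding has_cfc_def using assms by (intro allI impI exI[of _ p]) auto

lemma norm_has_cfc_le:
  assumes h: "star h = h" and a: "has_cfc h f a"
    and B: "\<And>t. \<bar>t\<bar> \<le> norm h \<Longrightarrow> \<bar>f t\<bar> \<le> B"
  shows "norm a \<le> B"
proof (rule field_le_epsilon)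
  fix e :: real assume "e > 0"
  then obtain p where p: "real_coeffs p" "norm (poly_at h p - a) < e / 2"
    "\<And>t. \<bar>t\<bar> \<le> norm h \<Longrightarrow> cmod (poly p (of_real t) - of_real (f t)) < e / 2"
    using has_cfcE[OF a, of "e / 2"] by auto
  have "norm (poly_at h p) \<le> B + e / 2"
  proof (rule norm_poly_at_le[OF h p(1)])
    fix t assume t: "\<bar>t\<bar> \<le> norm h"
    then show "cmod (poly p (of_real t)) \<le> B + e / 2"
      using p(3)[OF t] B[OF t] norm_triangle_ineq2[of "poly p (of_real t)" "of_real (f t)"]
      by (simp add: norm_of_real)
  qed
  then show "norm a \<le> B + e"
    using p(2) norm_triangle_ineq2[of a "poly_at h p"] by (simp add: norm_minus_commute)
qed

lemma has_cfc_add: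
  assumes "has_cfc h f a" "has_cfc h g b"
  shows "has_cfc h (\<lambda>t. f t + g t) (a + b)"
  unfolding has_cfc_def
proof (intro allI impI)
  fix e :: real assume "e > 0"
  then obtain p q where p: "real_coeffs p" "norm (poly_at h p - a) < e / 2"
      "\<And>t. \<bar>t\<bar> \<le> norm h \<Longrightarrow> cmod (poly p (of_real t) - of_real (f t)) < e / 2"
    and q: "real_coeffs q" "norm (poly_at h q - b) < e / 2"
      "\<And>t. \<bar>t\<bar> \<le> norm h \<Longrightarrow> cmod (poly q (of_real t) - of_real (g t)) < e / 2"
    using has_cfcE[OF assms(1), of "e / 2"] has_cfcE[OF assms(2), of "e / 2"] by (metis half_gt_zero)
  show "\<exists>p. real_coeffs p \<and>
     (\<forall>t. \<bar>t\<bar> \<le> norm h \<longrightarrow> cmod (poly p (of_real t) - of_real (f t + g t)) < e) \<and>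
     norm (poly_at h p - (a + b)) < e"
  proof (intro exI conjI allI impI)
    fix t assume t: "\<bar>t\<bar> \<le> norm h"
    show "cmod (poly (p + q) (of_real t) - of_real (f t + g t)) < e"
      using norm_diff_triangle_less[OF p(3)[OF t], of 0]
        norm_add_less[OF p(3)[OF t] q(3)[OF t]] by (simp add: algebra_simps)
  next
    show "norm (poly_at h (p + q) - (a + b)) < e"
      using norm_add_less[OF p(2) q(2)] by (simp add: poly_at_add algebra_simps)
  qed (use p q real_coeffs_add in auto)
qed

lemma has_cfc_scaleR:
  fixes h :: "'a::unital_cstar_algebra"
  assumes "has_cfc h f a"
  shows "has_cfc h (\<lambda>t. r * f t) (r *\<^sub>R a)"
  unfolding has_cfc_def
proof (intro allI impI)
  fix e :: real assume "e > 0"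
  then have d: "e / (\<bar>r\<bar> + 1) > 0" "\<bar>r\<bar> * (e / (\<bar>r\<bar> + 1)) < e"
    by (auto simp: divide_simps add_pos_nonneg)
  obtain p where p: "real_coeffs p" "norm (poly_at h p - a) < e / (\<bar>r\<bar> + 1)"
      "\<And>t. \<bar>t\<bar> \<le> norm h \<Longrightarrow> cmod (poly p (of_real t) - of_real (f t)) < e / (\<bar>r\<bar> + 1)"
    using has_cfcE[OF assms d(1)] by metis
  have less: "\<bar>r\<bar> * x < e" if "x < e / (\<bar>r\<bar> + 1)" for x
    using mult_left_mono[of x "e / (\<bar>r\<bar> + 1)" "\<bar>r\<bar>"] that d(2) by linarith
  show "\<exists>p. real_coeffs p \<and>
     (\<forall>t. \<bar>t\<bar> \<le> norm h \<longrightarrow> cmod (poly p (of_real t) - of_real (r * f t)) < e) \<and>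
     norm (poly_at h p - r *\<^sub>R a) < e"
  proof (intro exI conjI allI impI)
    fix t assume t: "\<bar>t\<bar> \<le> norm h"
    have "poly (smult (of_real r) p) (of_real t) - of_real (r * f t)
        = of_real r * (poly p (of_real t) - of_real (f t))"
      by (simp add: algebra_simps)
    then show "cmod (poly (smult (of_real r) p) (of_real t) - of_real (r * f t)) < e"
      using less[OF p(3)[OF t]] by (simp add: norm_mult)
  next
    have "poly_at h (smult (of_real r) p) - r *\<^sub>R a = r *\<^sub>R (poly_at h p - a)"
      by (simp add: poly_at_smult scaleR_diff_right flip: scaleR_scaleC)
    then show "norm (poly_at h (smult (of_real r) p) - r *\<^sub>R a) < e"
      using less[OF p(2)] by simp
  next
    show "real_coeffs (smult (of_real r) p)"
      using p(1) by (simp add: real_coeffs_def)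
  qed
qed

lemma has_cfc_unique:
  assumes h: "star h = h" and "has_cfc h f a" "has_cfc h f b"
  shows "a = b"
proof -
  have "has_cfc h (\<lambda>t. f t + (- 1) * f t) (a + (- 1) *\<^sub>R b)"
    by (intro has_cfc_add has_cfc_scaleR assms)
  then have "norm (a + (- 1) *\<^sub>R b) \<le> 0"
    by (rule norm_has_cfc_le[OF h]) simp
  then show ?thesis
    by simp
qed

lemma norm_mult_approx:
  fixes a b x y :: "'b::real_normed_algebra"
  assumes "norm (x - a) < d" "norm (y - b) < d" "d \<le> 1"
  shows "norm (x * y - a * b) \<le> d * (norm a + 1 + norm b)"
proof -
  have d: "0 \<le> d"
    using assms(1) norm_ge_zero[of "x - a"] by linarith
  have nx: "norm x \<le> norm a + 1"
    using assms norm_triangle_ineq2[of x a] by linarith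
  have "x * y - a * b = x * (y - b) + (x - a) * b"
    by (simp add: algebra_simps)
  also have "norm \<dots> \<le> norm x * norm (y - b) + norm (x - a) * norm b"
    by (intro norm_triangle_le add_mono norm_mult_ineq)
  also have "\<dots> \<le> (norm a + 1) * d + d * norm b"
    using assms nx d by (intro add_mono mult_mono) auto
  finally show ?thesis
    by (simp add: algebra_simps)
qed

lemma has_cfc_mult:
  assumes h: "star h = h" and a: "has_cfc h f a" and b: "has_cfc h g b"
    and F: "\<And>t. \<bar>t\<bar> \<le> norm h \<Longrightarrow> \<bar>f t\<bar> \<le> F" and G: "\<And>t. \<bar>t\<bar> \<le> norm h \<Longrightarrow> \<bar>g t\<bar> \<le> G"
  shows "has_cfc h (\<lambda>t. f t * g t) (a * b)"
  unfolding has_cfc_def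
proof (intro allI impI)
  fix e :: real assume e: "e > 0"
  define C where "C = F + 1 + G"
  have na: "norm a \<le> F" and nb: "norm b \<le> G"
    using norm_has_cfc_le[OF h a F] norm_has_cfc_le[OF h b G] by auto
  then have C: "C > 0" "norm a + 1 + norm b \<le> C"
    using norm_ge_zero[of a] norm_ge_zero[of b] unfolding C_def by linarith+
  define d where "d = min 1 (e / (2 * C))"
  have d: "d > 0" "d \<le> 1" "d * C < e"
  proof -
    have "d * C \<le> e / (2 * C) * C"
      using C by (intro mult_right_mono) (auto simp: d_def)
    then show "d > 0" "d \<le> 1" "d * C < e"
      using C e by (auto simp: d_def)
  qed
  obtain p where p: "real_coeffs p" "norm (poly_at h p - a) < d"
      "\<And>t. \<bar>t\<bar> \<le> norm h \<Longrightarrow> cmod (poly p (of_real t) - of_real (f t)) < d"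
    using has_cfcE[OF a d(1)] by metis
  obtain q where q: "real_coeffs q" "norm (poly_at h q - b) < d"
      "\<And>t. \<bar>t\<bar> \<le> norm h \<Longrightarrow> cmod (poly q (of_real t) - of_real (g t)) < d"
    using has_cfcE[OF b d(1)] by metis
  show "\<exists>p. real_coeffs p \<and>
     (\<forall>t. \<bar>t\<bar> \<le> norm h \<longrightarrow> cmod (poly p (of_real t) - of_real (f t * g t)) < e) \<and>
     norm (poly_at h p - a * b) < e"
  proof (intro exI conjI allI impI)
    fix t assume t: "\<bar>t\<bar> \<le> norm h"
    have "d * (cmod (of_real (f t)) + 1 + cmod (of_real (g t))) \<le> d * C"
      using F[OF t] G[OF t] d unfolding C_def by (intro mult_left_mono) auto
    from order_le_less_trans[OF order_trans[OF norm_mult_approx[OF p(3)[OF t] q(3)[OF t] d(2)] this] d(3)]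
    show "cmod (poly (p * q) (of_real t) - of_real (f t * g t)) < e"
      by simp
  next
    have "d * (norm a + 1 + norm b) \<le> d * C"
      using C d by (intro mult_left_mono) auto
    from order_le_less_trans[OF order_trans[OF norm_mult_approx[OF p(2) q(2) d(2)] this] d(3)]
    show "norm (poly_at h (p * q) - a * b) < e"
      by (simp add: poly_at_mult)
  qed (use p q real_coeffs_mult in auto)
qed

lemma has_cfc_exists:
  assumes h: "star h = h" and f: "continuous_on {- norm h..norm h} f"
  shows "\<exists>a. has_cfc h f a"
proof -
  have "\<exists>p. real_coeffs p \<and> (\<forall>t. \<bar>t\<bar> \<le> norm h \<longrightarrow>
      cmod (poly p (of_real t) - of_real (f t)) < 1 / Suc n)" for n
    using real_poly_approx[OF f, of "1 / Suc n"] by (metis zero_less_divide_1_iff of_nat_0_less_iff zero_less_Suc)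
  then obtain p where p: "\<And>n. real_coeffs (p n)"
      "\<And>n t. \<bar>t\<bar> \<le> norm h \<Longrightarrow> cmod (poly (p n) (of_real t) - of_real (f t)) < 1 / Suc n"
    by metis
  have diff: "norm (poly_at h (p m) - poly_at h (p n)) \<le> 1 / Suc m + 1 / Suc n" for m n
    unfolding poly_at_diff[symmetric]
  proof (rule norm_poly_at_le[OF h])
    fix t assume t: "\<bar>t\<bar> \<le> norm h"
    show "cmod (poly (p m - p n) (of_real t)) \<le> 1 / Suc m + 1 / Suc n"
      using norm_diff_triangle_le[of "poly (p m) (of_real t)" "of_real (f t)" _ "poly (p n) (of_real t)"]
        p(2)[OF t, of m] p(2)[OF t, of n] by (simp add: norm_minus_commute)
  qed (use p real_coeffs_diff in auto)
  have "Cauchy (\<lambda>n. poly_at h (p n))"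
  proof (rule metric_CauchyI)
    fix e :: real assume "e > 0"
    then obtain N where N: "inverse (real (Suc N)) < e / 2"
      using reals_Archimedean[of "e / 2"] by auto
    have small: "1 / real (Suc m) < e / 2" if "m \<ge> N" for m
    proof -
      have "1 / real (Suc m) \<le> inverse (real (Suc N))"
        using that by (simp add: divide_simps)
      then show ?thesis using N by simp
    qed
    show "\<exists>N. \<forall>m\<ge>N. \<forall>n\<ge>N. dist (poly_at h (p m)) (poly_at h (p n)) < e"
    proof (intro exI allI impI)
      fix m n assume "N \<le> m" "N \<le> n"
      then show "dist (poly_at h (p m)) (poly_at h (p n)) < e"
        using diff[of m n] small[of m] small[of n] unfolding dist_norm by linarith
    qed
  qed
  then obtain a where a: "(\<lambda>n. poly_at h (p n)) \<longlonglongrightarrow> a"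
    using Cauchy_convergent convergent_def by blast
  have "has_cfc h f a"
    unfolding has_cfc_def
  proof (intro allI impI)
    fix e :: real assume e: "e > 0"
    have "\<forall>\<^sub>F n in sequentially. dist (poly_at h (p n)) a < e"
      using a e by (rule tendstoD)
    moreover have "\<forall>\<^sub>F n in sequentially. inverse (real (Suc n)) < e"
      using LIMSEQ_inverse_real_of_nat e by (rule order_tendstoD)
    ultimately have "\<forall>\<^sub>F n in sequentially. dist (poly_at h (p n)) a < e \<and> inverse (real (Suc n)) < e"
      by (rule eventually_conj)
    then obtain n where n: "dist (poly_at h (p n)) a < e" "1 / real (Suc n) < e"
      unfolding eventually_sequentially inverse_eq_divide by blast
    show "\<exists>p. real_coeffs p \<and>
     (\<forall>t. \<bar>t\<bar> \<le> norm h \<longrightarrow> cmod (poly p (of_real t) - of_real (f t)) < e) \<and> norm (poly_at h p - a) < e"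
      using n p(1)[of n] p(2)[of _ n] by (intro exI[of _ "p n"]) (force simp: dist_norm)
  qed
  then show ?thesis ..
qed

definition cfc :: "'a::unital_cstar_algebra \<Rightarrow> (real \<Rightarrow> real) \<Rightarrow> 'a" where
  "cfc h f = (THE a. has_cfc h f a)"

lemma cfc_eqI:
  assumes "star h = h" "has_cfc h f a"
  shows "cfc h f = a"
  unfolding cfc_def using assms has_cfc_unique by blast

lemma has_cfc_cfc:
  assumes "star h = h" "continuous_on {- norm h..norm h} f"
  shows "has_cfc h f (cfc h f)"
  using has_cfc_exists[OF assms] cfc_eqI[OF assms(1)] by blast

lemma norm_cfc_le:
  assumes "star h = h" "continuous_on {- norm h..norm h} f"
    and "\<And>t. \<bar>t\<bar> \<le> norm h \<Longrightarrow> \<bar>f t\<bar> \<le> B"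
  shows "norm (cfc h f) \<le> B"
  using norm_has_cfc_le[OF assms(1) has_cfc_cfc[OF assms(1,2)] assms(3)] .

lemma cfc_cong:
  assumes "\<And>t. \<bar>t\<bar> \<le> norm h \<Longrightarrow> f t = g t"
  shows "cfc h f = cfc h g"
proof -
  have "has_cfc h f = has_cfc h g"
    unfolding has_cfc_def using assms by (auto simp: fun_eq_iff)
  then show ?thesis
    by (simp add: cfc_def)
qed

lemma cfc_add:
  assumes "star h = h" "continuous_on {- norm h..norm h} f" "continuous_on {- norm h..norm h} g"
  shows "cfc h (\<lambda>t. f t + g t) = cfc h f + cfc h g"
  using assms by (intro cfc_eqI has_cfc_add has_cfc_cfc)

lemma cfc_mult:
  assumes "star h = h" "continuous_on {- norm h..norm h} f" "continuous_on {- norm h..norm h} g"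
  shows "cfc h (\<lambda>t. f t * g t) = cfc h f * cfc h g"
proof -
  have bdd: "\<exists>B. \<forall>t. \<bar>t\<bar> \<le> norm h \<longrightarrow> \<bar>k t\<bar> \<le> B" if "continuous_on {- norm h..norm h} k" for k :: "real \<Rightarrow> real"
    using compact_imp_bounded[OF compact_continuous_image[OF that compact_Icc]]
    unfolding bounded_iff by (metis atLeastAtMost_iff abs_le_iff image_eqI minus_le_iff real_norm_def)
  obtain F G where "\<And>t. \<bar>t\<bar> \<le> norm h \<Longrightarrow> \<bar>f t\<bar> \<le> F" "\<And>t. \<bar>t\<bar> \<le> norm h \<Longrightarrow> \<bar>g t\<bar> \<le> G"
    using bdd[OF assms(2)] bdd[OF assms(3)] by metis
  then show ?thesis
    using assms by (intro cfc_eqI has_cfc_mult has_cfc_cfc)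
qed

lemma cfc_const: "star h = h \<Longrightarrow> cfc h (\<lambda>t. c) = c *\<^sub>R 1"
  using cfc_eqI[of h "\<lambda>t. c"] has_cfc_poly[of "[:of_real c:]" h "\<lambda>t. c"]
  by (simp add: real_coeffs_pCons scaleR_scaleC) (simp add: real_coeffs_def)

lemma cfc_ident: "star h = h \<Longrightarrow> cfc h (\<lambda>t. t) = h"
  using cfc_eqI[of h "\<lambda>t. t"] has_cfc_poly[of "[:0, 1:]" h "\<lambda>t. t"]
  by (simp add: real_coeffs_pCons) (simp add: real_coeffs_def)

lemma cfc_sum:
  assumes "star h = h" "finite I" "\<And>i. i \<in> I \<Longrightarrow> continuous_on {- norm h..norm h} (f i)"
  shows "cfc h (\<lambda>t. \<Sum>i\<in>I. f i t) = (\<Sum>i\<in>I. cfc h (f i))"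
  using assms(2,3)
  by (induction I rule: finite_induct)
    (simp_all add: cfc_const[OF assms(1)] cfc_add[OF assms(1)] continuous_on_sum)

lemma cfc_selfadjoint:
  assumes "star h = h" "continuous_on {- norm h..norm h} f"
  shows "star (cfc h f) = cfc h f"
proof -
  have "has_cfc h f (star (cfc h f))"
    unfolding has_cfc_def
  proof (intro allI impI)
    fix e :: real assume "e > 0"
    then obtain p where p: "real_coeffs p" "norm (poly_at h p - cfc h f) < e"
      "\<And>t. \<bar>t\<bar> \<le> norm h \<Longrightarrow> cmod (poly p (of_real t) - of_real (f t)) < e"
      using has_cfcE[OF has_cfc_cfc[OF assms]] by metis
    have "norm (poly_at h p - star (cfc h f)) = norm (star (poly_at h p - cfc h f))"
      by (simp only: star_diff poly_at_selfadjoint[OF assms(1) p(1)])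
    then show "\<exists>p. real_coeffs p \<and>
     (\<forall>t. \<bar>t\<bar> \<le> norm h \<longrightarrow> cmod (poly p (of_real t) - of_real (f t)) < e) \<and>
     norm (poly_at h p - star (cfc h f)) < e"
      using p by auto
  qed
  then show ?thesis
    using cfc_eqI[OF assms(1)] by metis
qed


section \<open>Derivations and square-zero elements\<close>

text \<open>
  The invertible elements \<open>1 + t a\<close> with \<open>t\<close> tending to \<open>0\<close>. A polynomial identity valid for all of
  these and their inverses yields in the limit its derivative at \<open>t = 0\<close>. A derivation \<open>D\<close> enters
  such an identity only through the fixed element \<open>D(a)\<close>, because \<open>D(1 + t a) = t D(a)\<close>.
\<close>

lemma inverses_near_one:
  fixes a :: "'a::unital_cstar_algebra"
  obtains t :: "nat \<Rightarrow> real" and v :: "nat \<Rightarrow> 'a"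
  where "\<And>n. t n > 0" "\<And>n. (1 + t n *\<^sub>R a) * v n = 1" "\<And>n. v n * (1 + t n *\<^sub>R a) = 1"
    "v \<longlonglongrightarrow> 1"
proof -
  define q where "q = 1 + norm a"
  define t where "t n = inverse (real (Suc n)) / (2 * q)" for n
  have q: "0 < q" "norm a \<le> q"
    by (simp_all add: q_def add_pos_nonneg)
  then have tpos: "t n > 0" for n
    by (simp add: t_def)
  have t: "t n * norm a \<le> 1 / 2" for n
  proof -
    have "t n * norm a \<le> t n * q"
      using tpos[of n] q by (intro mult_left_mono) auto
    also have "\<dots> = inverse (real (Suc n)) / 2"
      using q by (simp add: t_def)
    also have "\<dots> \<le> 1 / 2"
      by (simp add: divide_simps)
    finally show ?thesis .
  qed
  have "\<exists>v. (1 + t n *\<^sub>R a) * v = 1 \<and> v * (1 + t n *\<^sub>R a) = 1" for n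
    using invertible_one_minus[of "- (t n *\<^sub>R a)"] t[of n] tpos[of n]
    by (auto simp: invertible_wrt_def)
  then obtain v where v: "\<And>n. (1 + t n *\<^sub>R a) * v n = 1" "\<And>n. v n * (1 + t n *\<^sub>R a) = 1"
    by metis
  have eq: "v n - 1 = - (t n *\<^sub>R (a * v n))" for n
    using v(1)[of n] by (simp add: algebra_simps eq_neg_iff_add_eq_0)
  have diff: "norm (v n - 1) \<le> t n * norm a * norm (v n)" for n
    unfolding eq using norm_mult_ineq[of a "v n"] tpos[of n] by (simp add: mult.assoc)
  have nv: "norm (v n) \<le> 2" for n
  proof -
    have "t n * norm a * norm (v n) \<le> 1 / 2 * norm (v n)"
      by (intro mult_right_mono t) auto
    then show ?thesis
      using diff[of n] norm_triangle_ineq2[of "v n" 1] by simp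
  qed
  have "v \<longlonglongrightarrow> 1"
  proof (rule Lim_transform_bound[THEN Lim_null[THEN iffD2]])
    show "\<forall>\<^sub>F n in sequentially. norm (v n - 1) \<le> norm (inverse (real (Suc n)))"
    proof (intro always_eventually allI)
      fix n
      have "t n * norm a * norm (v n) \<le> t n * norm a * 2"
        using nv[of n] tpos[of n] by (intro mult_left_mono) auto
      also have "\<dots> \<le> t n * (2 * q)"
        using tpos[of n] q by simp
      also have "\<dots> = inverse (real (Suc n))"
        using q by (simp add: t_def)
      finally show "norm (v n - 1) \<le> norm (inverse (real (Suc n)))"
        using diff[of n] by simp
    qed
    show "(\<lambda>n. inverse (real (Suc n))) \<longlonglongrightarrow> 0"
      by (rule LIMSEQ_inverse_real_of_nat)
  qed
  with tpos v show thesis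
    using that by blast
qed

text \<open>
  The hypothesis on quasinilpotent elements in a form that passes from an algebra to its
  unitization.
\<close>

locale quasinilpotent_derivation =
  fixes D :: "'a::unital_cstar_algebra \<Rightarrow> 'a"
  assumes D_add: "D (x + y) = D x + D y"
    and D_scaleC: "D (c *\<^sub>C x) = c *\<^sub>C D x"
    and D_mult: "D (x * y) = D x * y + x * D y"
    and square_zero_quasinilpotent:
      "x * x = 0 \<Longrightarrow> c \<noteq> 0 \<Longrightarrow> invertible_wrt (*) 1 (c *\<^sub>C 1 - D x)"
begin

lemma D_0 [simp]: "D 0 = 0"
  using D_add[of 0 0] by simp

lemma D_1 [simp]: "D 1 = 0"
  using D_mult[of 1 1] by simp

lemma D_scaleR: "D (r *\<^sub>R x) = r *\<^sub>R D x"
  by (simp add: scaleR_scaleC D_scaleC)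

lemma D_minus: "D (- x) = - D x"
  using D_scaleR[of "- 1" x] by simp

lemma D_diff: "D (x - y) = D x - D y"
  using D_add[of x "- y"] by (simp add: D_minus)

text \<open>
  Let \<open>y = D(x)\<close>, so that \<open>x y = - y x\<close>, and let \<open>w = D(a) x + a y\<close>. Then
  \<open>z = D(x a x) = y (a x) + x w\<close> is the product of the row \<open>(y, x)\<close> and the column \<open>(a x, w)\<close>. The
  product in the opposite order is a 2 by 2 matrix, which is lower triangular because \<open>x x = 0\<close>, and
  its first diagonal entry is \<open>a x y\<close>. As \<open>x a x\<close> is square-zero, \<open>z\<close> has no nonzero spectrum, so
  neither has the matrix, and \<open>r - a x y\<close> has a right inverse for \<open>r \<noteq> 0\<close>. The choice \<open>a = (x y)\<^sup>*\<close>
  makes \<open>a x y\<close> self-adjoint, and then the one-sided inverses already force it to be zero.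
\<close>

lemma square_zero_mult_D_self:
  assumes x: "x * x = 0"
  shows "x * D x = 0"
proof (rule ccontr)
  assume ne: "x * D x \<noteq> 0"
  define y where "y = D x"
  define a where "a = star (x * y)"
  define s where "s = a * x * y"
  have s: "star s = s" "s \<noteq> 0"
    using ne star_mult_self_eq_0[of "x * y"]
    by (auto simp: s_def a_def y_def star_mult star_star mult.assoc)
  define z where "z = D (x * a * x)"
  have xz: "x * z = x * y * a * x"
    using x unfolding z_def y_def D_mult by (simp add: algebra_simps flip: mult.assoc)
  have "\<exists>N. (r *\<^sub>R 1 - s) * N = 1" if r: "r \<noteq> 0" for r
  proof -
    have "(x * a * x) * (x * a * x) = x * a * (x * x) * a * x"
      by (simp only: mult.assoc)
    then have "invertible_wrt (*) 1 (of_real r *\<^sub>C 1 - z)"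
      unfolding z_def using x r by (intro square_zero_quasinilpotent) auto
    then obtain R where "(r *\<^sub>R 1 - z) * R = 1"
      by (auto simp: invertible_wrt_def scaleR_scaleC)
    then have "z * R = r *\<^sub>R R - 1"
      by (simp add: algebra_simps)
    then have "x * y * a * x * R = x * (r *\<^sub>R R - 1)"
      using xz by (metis mult.assoc)
    then have "a * (x * y * a * x * R) * y = a * (x * (r *\<^sub>R R - 1)) * y"
      by simp
    \<comment> \<open>The upper left entry of the inverse of the matrix, up to the factor \<open>1 / r\<close>.\<close>
    then have "(r *\<^sub>R 1 - s) * (1 + a * x * R * y) = r *\<^sub>R 1"
      by (simp add: s_def algebra_simps)
    then have "(r *\<^sub>R 1 - s) * ((1 / r) *\<^sub>R (1 + a * x * R * y)) = 1"
      using r by simp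
    then show ?thesis ..
  qed
  moreover have "star (r *\<^sub>R 1 - s) = r *\<^sub>R 1 - s" for r
    by (simp add: star_diff star_scaleR s)
  \<comment> \<open>The adjoint of a right inverse of a self-adjoint element is a left inverse.\<close>
  ultimately have inv: "invertible_wrt (*) 1 (r *\<^sub>R 1 - s)" if "r \<noteq> 0" for r
    using that invertible_if_left_right by (metis star_1 star_mult)
  have "invertible_wrt (*) 1 ((-1) *\<^sub>R ((norm s *\<^sub>R 1 - s) * ((- norm s) *\<^sub>R 1 - s)))"
    using s by (intro invertible_scaleR invertible_mult inv) auto
  also have "(-1) *\<^sub>R ((norm s *\<^sub>R 1 - s) * ((- norm s) *\<^sub>R 1 - s)) = (norm s)\<^sup>2 *\<^sub>R 1 - s * s"
    by (simp add: algebra_simps power2_eq_square)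
  finally show False
    using norm_square_minus_square_not_invertible[OF s] by blast
qed

lemma D_conjugate:
  assumes "u * v = 1" "v * u = 1"
  shows "D (u * x * v) = u * (v * D u * x + D x - x * v * D u) * v"
proof -
  have "D u * v + u * D v = 0"
    using D_mult[of u v] assms by simp
  then have "v * (D u * v + u * D v) = 0"
    by simp
  then have "D v = - (v * D u * v)"
    using assms(2) by (simp add: distrib_left mult.assoc eq_neg_iff_add_eq_0 add.commute flip: mult.assoc[of v u])
  moreover have "D u * x * v = u * v * D u * x * v"
    by (simp add: assms(1))
  ultimately show ?thesis
    by (simp add: D_mult algebra_simps)
qed

text \<open>
  The relation \<open>x D(x) = 0\<close> also holds for the conjugates of \<open>x\<close> by \<open>1 + t a\<close>; differentiate at
  \<open>t = 0\<close>.
\<close>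

lemma square_zero_sandwich_D:
  assumes x: "x * x = 0"
  shows "x * D a * x = 0"
proof -
  obtain t v where t: "\<And>n. t n > 0" and v: "\<And>n. (1 + t n *\<^sub>R a) * v n = 1"
    "\<And>n. v n * (1 + t n *\<^sub>R a) = 1" "v \<longlonglongrightarrow> 1"
    using inverses_near_one[of a] by metis
  have "x * v n * D a * x = 0" for n
  proof -
    define u where "u = 1 + t n *\<^sub>R a"
    have uv: "u * v n = 1" "v n * u = 1"
      using v by (simp_all add: u_def)
    have conj: "(u * b * v n) * (u * c * v n) = u * (b * c) * v n" for b c
      by (metis mult.assoc mult_1_left uv(2))
    have "u * (x * (v n * D u * x + D x - x * v n * D u)) * v n = 0"
      using square_zero_mult_D_self[of "u * x * v n"] x
      unfolding D_conjugate[OF uv] conj by simp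
    then have "u * (x * v n * D u * x) * v n = 0"
      using square_zero_mult_D_self[OF x] x by (simp add: distrib_left right_diff_distrib flip: mult.assoc)
    then have "v n * (u * (x * v n * D u * x) * v n) * u = 0"
      by simp
    then have "x * v n * D u * x = 0"
      by (metis mult.assoc mult_1_left mult_1_right uv(2))
    then show ?thesis
      using t[of n] by (simp add: u_def D_add D_scaleR)
  qed
  moreover have "(\<lambda>n. x * v n * D a * x) \<longlonglongrightarrow> x * 1 * D a * x"
    by (intro tendsto_intros v)
  ultimately show ?thesis
    by (simp add: LIMSEQ_const_iff)
qed

text \<open>
  Inserting products for \<open>a\<close> in \<open>x D(a) x = 0\<close> shows that the ideals generated by \<open>x\<close> and by
  \<open>y = D(x)\<close> annihilate each other. Applying \<open>D\<close> to \<open>x a y = 0\<close> then expresses \<open>y a y\<close> as an element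
  \<open>- x a D(y)\<close> of the first ideal, so that it is killed by \<open>y\<close>.
\<close>

lemma D_square_zero:
  assumes x: "x * x = 0"
  shows "D x = 0"
proof -
  define y where "y = D x"
  have long: "x * a * y * c * x = 0" for a c
  proof -
    have "x * D (a * x * c) * x = x * D a * x * c * x + x * a * y * c * x + x * a * (x * D c * x)"
      by (simp add: D_mult y_def algebra_simps)
    then show ?thesis
      by (simp add: square_zero_sandwich_D[OF x])
  qed
  have xay: "x * a * y = 0" for a
  proof (rule semiprime)
    fix b
    have "x * a * y * b * (x * a * y) = (x * a * y * b * x) * a * y"
      by (simp only: mult.assoc)
    then show "x * a * y * b * (x * a * y) = 0"
      by (simp add: long)
  qed
  have yax: "y * a * x = 0" for a
  proof (rule semiprime)
    fix b
    have "y * a * x * b * (y * a * x) = y * a * (x * b * y * a * x)"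
      by (simp only: mult.assoc)
    then show "y * a * x * b * (y * a * x) = 0"
      by (simp add: long)
  qed
  have "y * a * y = - (x * a * D y)" for a
  proof -
    have "D (x * a * y) = y * a * y + x * D a * y + x * a * D y"
      by (simp add: D_mult y_def algebra_simps)
    then show ?thesis
      by (simp add: xay eq_neg_iff_add_eq_0)
  qed
  then have "y * c * y * a * y = - (y * c * x * a * D y)" for a c
    by (metis mult.assoc mult_minus_right)
  then have long': "y * c * y * a * y = 0" for a c
    by (simp add: yax)
  have "y * c * y = 0" for c
  proof (rule semiprime)
    fix b
    have "y * c * y * b * (y * c * y) = (y * c * y * b * y) * c * y"
      by (simp only: mult.assoc)
    then show "y * c * y * b * (y * c * y) = 0"
      by (simp add: long')
  qed
  then show ?thesis
    unfolding y_def by (rule semiprime)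
qed

text \<open>
  The conjugates of \<open>x\<close> by \<open>1 + t a\<close> are killed by \<open>D\<close> as well; differentiate at \<open>t = 0\<close>.
\<close>

lemma D_commutes_square_zero:
  assumes x: "x * x = 0"
  shows "D a * x = x * D a"
proof -
  obtain t v where t: "\<And>n. t n > 0" and v: "\<And>n. (1 + t n *\<^sub>R a) * v n = 1"
    "\<And>n. v n * (1 + t n *\<^sub>R a) = 1" "v \<longlonglongrightarrow> 1"
    using inverses_near_one[of a] by metis
  have "v n * D a * x - x * v n * D a = 0" for n
  proof -
    define u where "u = 1 + t n *\<^sub>R a"
    have uv: "u * v n = 1" "v n * u = 1"
      using v by (simp_all add: u_def)
    have "(u * x * v n) * (u * x * v n) = u * (x * x) * v n"
      by (metis mult.assoc mult_1_left uv(2))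
    then have "D (u * x * v n) = 0"
      using x by (intro D_square_zero) simp
    then have "u * (v n * D u * x - x * v n * D u) * v n = 0"
      unfolding D_conjugate[OF uv] D_square_zero[OF x] by simp
    then have "v n * (u * (v n * D u * x - x * v n * D u) * v n) * u = 0"
      by simp
    then have "v n * D u * x - x * v n * D u = 0"
      by (metis mult.assoc mult_1_left mult_1_right uv(2))
    then have "t n *\<^sub>R (v n * D a * x - x * v n * D a) = 0"
      by (simp add: u_def D_add D_scaleR scaleR_diff_right)
    then show ?thesis
      using t[of n] by simp
  qed
  moreover have "(\<lambda>n. v n * D a * x - x * v n * D a) \<longlonglongrightarrow> 1 * D a * x - x * 1 * D a"
    by (intro tendsto_intros v)
  ultimately show ?thesis
    by (simp add: LIMSEQ_const_iff)
qed

text \<open>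
  By now \<open>D\<close> kills \<open>x\<close> and all commutators \<open>[x, c]\<close>. With \<open>v = [a, x]\<close> the identity
  \<open>2 x a x b = [x, v] b = [x, v b] - v [x, b]\<close> shows that it kills every \<open>x a x b\<close>, whence
  \<open>x a x D(b) = 0\<close>. This is Herstein's way of finding an ideal inside the subring generated by a
  Lie ideal.
\<close>

lemma square_zero_mult_D:
  assumes x: "x * x = 0"
  shows "x * D b = 0"
proof -
  define a where "a = star x"
  define v where "v = a * x - x * a"
  have kill: "D (x * c - c * x) = 0" for c
    by (simp add: D_diff D_mult D_square_zero[OF x] D_commutes_square_zero[OF x])
  have Dv: "D v = 0"
    using kill[of a] by (simp add: v_def D_diff)
  have xv: "x * v - v * x = 2 *\<^sub>R (x * a * x)"
    using x by (simp add: v_def right_diff_distrib left_diff_distrib mult.assoc scaleR_2)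
       (simp flip: mult.assoc)
  have "(x * v - v * x) * b = (x * (v * b) - v * b * x) - v * (x * b - b * x)"
    by (simp add: algebra_simps)
  then have "D ((x * v - v * x) * b) = 0"
    by (simp add: D_diff[of "x * (v * b) - v * b * x"] kill D_mult[of v "x * b - b * x"] Dv
        del: mult.assoc)
  then have "(x * v - v * x) * D b = 0"
    by (simp add: D_mult[of "x * v - v * x"] kill)
  then have "x * star x * x * D b = 0"
    unfolding xv by (simp add: a_def)
  then show ?thesis
    by (rule cancel_star_left)
qed

lemma square_zero_mult_ideal:
  assumes x: "x * x = 0"
  shows "x * b * D c = 0"
proof -
  have "x * D (b * c) = x * D b * c + x * b * D c"
    by (simp add: D_mult algebra_simps)
  then show ?thesis
    by (simp add: square_zero_mult_D[OF x])
qed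

text \<open>
  The element \<open>x = f D(c) y g\<close> has square zero, so it annihilates the ideal generated by the range of
  \<open>D\<close>, to which it belongs itself. Thus the range of \<open>D\<close> does not connect orthogonal elements, as
  if the algebra were commutative.
\<close>

lemma orthogonal_sandwich:
  assumes "g * f = 0"
  shows "f * D c * y * g = 0"
proof (rule semiprime)
  fix b
  define x where "x = f * D c * y * g"
  have "x * x = f * D c * y * (g * f) * D c * y * g"
    by (simp only: x_def mult.assoc)
  then have "x * (b * f) * D c = 0"
    using assms by (intro square_zero_mult_ideal) simp
  then have "x * (b * f) * D c * y * g = 0"
    by simp
  then show "f * D c * y * g * b * (f * D c * y * g) = 0"
    by (simp only: x_def mult.assoc)
qed

end


section \<open>Norms of orthogonal sums\<close>

text \<open>
  As \<open>(1 - a\<^sup>2) (1 - b\<^sup>2) = 1 - (a + b)\<^sup>2\<close>, the element \<open>1 - (a + b)\<^sup>2\<close> is the square of the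
  self-adjoint contraction \<open>k = sqrt (1 - a\<^sup>2) sqrt (1 - b\<^sup>2)\<close>, and \<open>norm (1 - k\<^sup>2) \<le> 1\<close>.
\<close>

lemma norm_orthogonal_selfadjoint_sum_le:
  fixes a b :: "'a::unital_cstar_algebra"
  assumes a: "star a = a" "norm a \<le> 1" and b: "star b = b" "norm b \<le> 1"
    and ab: "a * b = 0" "b * a = 0"
  shows "norm (a + b) \<le> 1"
proof -
  define p where "p = sqrt_one_minus (a * a)"
  define q where "q = sqrt_one_minus (b * b)"
  have sq: "norm (c * c) \<le> 1" "star (c * c) = c * c"
    if "star c = c" "norm c \<le> 1" for c :: 'a
    using norm_mult_ineq[of c c] mult_le_one[of "norm c" "norm c"] that by (auto simp: star_mult)
  have p: "p * p = 1 - a * a" "star p = p" and q: "q * q = 1 - b * b" "star q = q"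
    using sq a b by (simp_all add: p_def q_def sqrt_one_minus_square sqrt_one_minus_selfadjoint)
  have aabb: "a * a * (b * b) = 0" "b * b * (a * a) = 0"
    using ab by (metis mult.assoc mult_zero_left mult_zero_right)+
  then have "p * (b * b) = b * b * p"
    unfolding p_def using sq a by (intro sqrt_one_minus_commute) auto
  then have qp: "q * p = p * q"
    unfolding q_def using sq b by (intro sqrt_one_minus_commute) auto
  have n: "norm c \<le> 1" if "star c = c" "norm (c * c) \<le> 1" for c :: 'a
    using that cstar_identity[of c] power2_le_imp_le[of "norm c" 1] by simp
  have "norm p \<le> 1" "norm q \<le> 1"
    using n[of p] n[of q] p q norm_one_minus_square_le a b by auto
  then have "norm (p * q) \<le> 1"
    using norm_mult_ineq[of p q] mult_le_one[of "norm p" "norm q"] by auto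
  moreover have "star (p * q) = p * q"
    by (simp add: star_mult p q qp)
  ultimately have "norm (1 - (p * q) * (p * q)) \<le> 1"
    by (rule norm_one_minus_square_le[rotated])
  also have "(p * q) * (p * q) = (p * p) * (q * q)"
    by (metis mult.assoc qp)
  also have "1 - (p * p) * (q * q) = (a + b) * (a + b)"
    unfolding p q using aabb ab by (simp add: algebra_simps)
  finally show ?thesis
    by (rule n[rotated]) (simp add: star_add a b)
qed

lemma norm_orthogonal_sum_le:
  fixes a b :: "'a::unital_cstar_algebra"
  assumes "e > 0" "norm a \<le> e" "norm b \<le> e" and ab: "star a * b = 0" "a * star b = 0"
  shows "norm (a + b) \<le> e"
proof -
  define A where "A = (1 / e) *\<^sub>R a"
  define B where "B = (1 / e) *\<^sub>R b"
  have nA: "norm A \<le> 1" and nB: "norm B \<le> 1"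
    using assms by (auto simp: A_def B_def)
  have AB: "star A * B = 0" "A * star B = 0"
    by (simp_all add: A_def B_def star_scaleR ab)
  have BA: "star B * A = 0" "B * star A = 0"
    using AB by (metis star_0 star_mult star_star)+
  have "norm (star A * A + star B * B) \<le> 1"
  proof (rule norm_orthogonal_selfadjoint_sum_le)
    show "norm (star A * A) \<le> 1" "norm (star B * B) \<le> 1"
      using nA nB by (simp_all add: cstar_identity power_le_one)
    have "star A * A * (star B * B) = star A * (A * star B) * B"
      "star B * B * (star A * A) = star B * (B * star A) * A"
      by (simp_all only: mult.assoc)
    then show "star A * A * (star B * B) = 0" "star B * B * (star A * A) = 0"
      by (simp_all add: AB BA)
  qed (simp_all add: star_mult star_star)
  also have "star A * A + star B * B = star (A + B) * (A + B)"
    by (simp add: star_add algebra_simps AB BA)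
  finally have "norm (A + B) \<le> 1"
    using power2_le_imp_le[of "norm (A + B)" 1] by (simp add: cstar_identity)
  also have "A + B = (1 / e) *\<^sub>R (a + b)"
    by (simp add: A_def B_def scaleR_add_right)
  finally show ?thesis
    using \<open>e > 0\<close> by (simp add: divide_simps)
qed

lemma norm_orthogonal_family_le:
  fixes w :: "'i \<Rightarrow> 'a::unital_cstar_algebra"
  assumes "finite I" "e > 0" "\<And>i. i \<in> I \<Longrightarrow> norm (w i) \<le> e"
    and "\<And>i j. i \<in> I \<Longrightarrow> j \<in> I \<Longrightarrow> i \<noteq> j \<Longrightarrow> star (w i) * w j = 0 \<and> w i * star (w j) = 0"
  shows "norm (\<Sum>i\<in>I. w i) \<le> e"
  using assms(1,3,4)
proof (induction I rule: finite_induct)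
  case (insert i I)
  have "norm (w i + (\<Sum>i\<in>I. w i)) \<le> e"
  proof (rule norm_orthogonal_sum_le)
    show "norm (\<Sum>i\<in>I. w i) \<le> e"
      using insert by simp
    have "star (w i) * w j = 0 \<and> w i * star (w j) = 0" if "j \<in> I" for j
      using insert that by (metis insertCI)
    then show "star (w i) * (\<Sum>i\<in>I. w i) = 0" "w i * star (\<Sum>i\<in>I. w i) = 0"
      by (simp_all add: sum_distrib_left star_sum)
  qed (use insert \<open>e > 0\<close> in auto)
  then show ?case
    using insert by simp
qed (use \<open>e > 0\<close> in simp)


section \<open>Derivations vanish on self-adjoint elements\<close>

context quasinilpotent_derivation
begin

text \<open>
  Write \<open>h - r = K A\<close>, where \<open>K\<close> and \<open>A\<close> are functions of \<open>h\<close> of size \<open>sqrt \<bar>h - r\<bar>\<close>. In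
  \<open>D(h) = D(K) A + K D(A)\<close> a function \<open>\<phi>(h)\<close> supported near \<open>r\<close> makes the factor \<open>K\<close> small at once, and
  it makes \<open>A\<close> small as well, because \<open>\<phi>(h) D(K)\<close> is not changed by multiplication on the right with
  a function of \<open>h\<close> that is \<open>1\<close> on the support of \<open>\<phi>\<close>. The norms of \<open>D(K)\<close> and \<open>D(A)\<close> are constants
  that do not depend on \<open>\<phi>\<close>.
\<close>

lemma D_locally_small:
  assumes h: "star h = h" and e: "e > 0"
  obtains d where "d > 0"
    "\<And>\<phi>. continuous_on UNIV \<phi> \<Longrightarrow> (\<And>t. \<bar>\<phi> t\<bar> \<le> 1) \<Longrightarrow> (\<And>t. d \<le> \<bar>t - r\<bar> \<Longrightarrow> \<phi> t = 0) \<Longrightarrow>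
      norm (cfc h \<phi> * D h) \<le> e"
proof -
  define \<kappa> where "\<kappa> t = sqrt (max 0 (t - r)) - sqrt (max 0 (r - t))" for t
  define \<alpha> where "\<alpha> t = sqrt \<bar>t - r\<bar>" for t
  define K where "K = cfc h \<kappa>"
  define A where "A = cfc h \<alpha>"
  define C where "C = norm (D K) + norm (D A) + 1"
  \<comment> \<open>On the support of \<open>\<psi>\<close>, of radius \<open>2 d\<close>, both factors are at most \<open>sqrt (2 d) = e / C\<close>.\<close>
  define d where "d = (e / C)\<^sup>2 / 2"
  have C: "C > 0"
    by (simp add: C_def add_nonneg_pos)
  have d: "d > 0" "sqrt (2 * d) = e / C" "sqrt d \<le> e / C"
  proof -
    show "sqrt (2 * d) = e / C"
      using C e by (simp add: d_def)
    then show "d > 0" "sqrt d \<le> e / C"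
      using C e real_sqrt_le_mono[of d "2 * d"] by (auto simp: d_def)
  qed
  have cont_\<kappa>: "continuous_on S \<kappa>" and cont_\<alpha>: "continuous_on S \<alpha>" for S
    unfolding \<kappa>_def \<alpha>_def by (intro continuous_intros)+
  have "\<kappa> t * \<alpha> t = t + (- r)" for t
    by (cases "r \<le> t") (auto simp: \<kappa>_def \<alpha>_def max_def)
  then have "K * A = cfc h (\<lambda>t. t + (- r))"
    unfolding K_def A_def using cfc_mult[OF h cont_\<kappa> cont_\<alpha>] by simp
  also have "\<dots> = h - r *\<^sub>R 1"
    by (subst cfc_add[OF h]) (simp_all add: cfc_ident cfc_const h)
  finally have "D h = D (K * A)"
    by (simp add: D_diff D_scaleR)
  then have Dh: "D h = D K * A + K * D A"
    by (simp add: D_mult)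
  show thesis
  proof (rule that[OF d(1)])
    fix \<phi> :: "real \<Rightarrow> real"
    assume cont': "continuous_on UNIV \<phi>" and bd: "\<And>t. \<bar>\<phi> t\<bar> \<le> 1"
      and supp: "\<And>t. d \<le> \<bar>t - r\<bar> \<Longrightarrow> \<phi> t = 0"
    define \<psi> where "\<psi> t = max 0 (min 1 (2 - \<bar>t - r\<bar> / d))" for t
    have cont_\<phi>: "continuous_on S \<phi>" for S
      using continuous_on_subset[OF cont'] by blast
    have cont_\<psi>: "continuous_on S \<psi>" "continuous_on S (\<lambda>t. 1 - \<psi> t)" for S
      unfolding \<psi>_def using d(1) by (intro continuous_intros; simp)+
    define F where "F = cfc h \<phi>"
    define P where "P = cfc h \<psi>"
    define G where "G = cfc h (\<lambda>t. 1 - \<psi> t)"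
    have disj: "(1 - \<psi> t) * \<phi> t = 0" for t
      using supp[of t] d(1) by (cases "d \<le> \<bar>t - r\<bar>") (auto simp: \<psi>_def divide_simps max_def min_def)
    have "G * F = cfc h (\<lambda>t. (1 - \<psi> t) * \<phi> t)"
      unfolding G_def F_def by (rule cfc_mult[OF h cont_\<psi>(2) cont_\<phi>, symmetric])
    then have "G * F = 0"
      unfolding disj using cfc_const[OF h, of 0] by simp
    then have "F * D K * G = 0"
      using orthogonal_sandwich[of G F K 1] by simp
    moreover have "P + G = 1"
      unfolding P_def G_def using cfc_add[OF h cont_\<psi>] cfc_const[OF h, of 1] by simp
    ultimately have FDK: "F * D K = F * D K * P"
      by (metis add.right_neutral distrib_left mult_1_right)
    have small: "norm (P * A) \<le> e / C"
      unfolding P_def A_def cfc_mult[OF h cont_\<psi>(1) cont_\<alpha>, symmetric]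
    proof (rule norm_cfc_le[OF h])
      show "continuous_on {- norm h..norm h} (\<lambda>t. \<psi> t * \<alpha> t)"
        by (intro continuous_intros cont_\<psi> cont_\<alpha>)
      fix t
      have "\<bar>\<psi> t * \<alpha> t\<bar> \<le> sqrt (2 * d)"
      proof (cases "2 * d \<le> \<bar>t - r\<bar>")
        case True
        then have "\<psi> t = 0"
          using d(1) by (auto simp: \<psi>_def divide_simps max_def min_def)
        then show ?thesis
          using d(1) by simp
      next
        case False
        then have "\<alpha> t \<le> sqrt (2 * d)" "0 \<le> \<alpha> t"
          by (auto simp: \<alpha>_def)
        moreover have "\<bar>\<psi> t\<bar> \<le> 1"
          by (simp add: \<psi>_def)
        ultimately show ?thesis
          using mult_mono[of "\<bar>\<psi> t\<bar>" 1 "\<alpha> t" "sqrt (2 * d)"] by (simp add: abs_mult)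
      qed
      then show "\<bar>\<psi> t * \<alpha> t\<bar> \<le> e / C"
        using d by simp
    qed
    have FK: "norm (F * K) \<le> e / C"
      unfolding F_def K_def cfc_mult[OF h cont_\<phi> cont_\<kappa>, symmetric]
    proof (rule norm_cfc_le[OF h])
      show "continuous_on {- norm h..norm h} (\<lambda>t. \<phi> t * \<kappa> t)"
        by (intro continuous_intros cont_\<phi> cont_\<kappa>)
      fix t
      have "\<bar>\<phi> t * \<kappa> t\<bar> \<le> sqrt d"
      proof (cases "d \<le> \<bar>t - r\<bar>")
        case True
        then show ?thesis
          using supp d(1) by simp
      next
        case False
        then have "\<bar>\<kappa> t\<bar> \<le> sqrt d"
          by (cases "r \<le> t") (auto simp: \<kappa>_def max_def)
        then show ?thesis
          using mult_mono[of "\<bar>\<phi> t\<bar>" 1 "\<bar>\<kappa> t\<bar>" "sqrt d"] bd[of t] by (simp add: abs_mult)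
      qed
      then show "\<bar>\<phi> t * \<kappa> t\<bar> \<le> e / C"
        using d by simp
    qed
    have nF: "norm F \<le> 1"
      unfolding F_def by (rule norm_cfc_le[OF h cont_\<phi>]) (rule bd)
    have "F * D h = F * D K * A + F * K * D A"
      by (simp only: Dh distrib_left mult.assoc)
    also have "F * D K * A = F * (D K * (P * A))"
      by (subst FDK) (simp only: mult.assoc)
    finally have "norm (F * D h) \<le> norm F * (norm (D K) * norm (P * A)) + norm (F * K) * norm (D A)"
      by (simp add: norm_triangle_le add_mono norm_mult_ineq order_trans[OF norm_mult_ineq] mult_left_mono)
    also have "\<dots> \<le> 1 * (norm (D K) * (e / C)) + e / C * norm (D A)"
      using nF small FK e C by (intro add_mono mult_mono) auto
    also have "\<dots> = (norm (D K) + norm (D A)) * (e / C)"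
      by (simp only: distrib_right mult_1_left mult.commute[of "e / C"])
    also have "\<dots> \<le> C * (e / C)"
      using e C by (intro mult_right_mono) (auto simp: C_def)
    finally show "norm (cfc h \<phi> * D h) \<le> e"
      using C by (simp add: F_def)
  qed
qed

end

definition tent :: "real \<Rightarrow> real" where
  "tent x = max 0 (1 - \<bar>x\<bar>)"

lemma sum_tent:
  fixes N :: nat
  assumes "\<bar>s\<bar> \<le> real N"
  shows "(\<Sum>i\<in>{- int N..int N}. tent (s - real_of_int i)) = 1"
proof (cases "s = real N")
  case True
  have "(\<Sum>i\<in>{- int N..int N}. tent (s - real_of_int i)) = (\<Sum>i\<in>{int N}. tent (s - real_of_int i))"
    by (rule sum.mono_neutral_right) (auto simp: tent_def True)
  then show ?thesis
    by (simp add: tent_def True)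
next
  case False
  define k where "k = \<lfloor>s\<rfloor>"
  have k: "real_of_int k \<le> s" "s < real_of_int k + 1"
    by (auto simp: k_def)
  have "- int N \<le> k" "k + 1 \<le> int N"
    using assms False k by linarith+
  then have "(\<Sum>i\<in>{- int N..int N}. tent (s - real_of_int i)) = (\<Sum>i\<in>{k, k + 1}. tent (s - real_of_int i))"
  proof (intro sum.mono_neutral_right ballI)
    fix i assume "i \<in> {- int N..int N} - {k, k + 1}"
    then have "i \<le> k - 1 \<or> k + 2 \<le> i"
      by auto
    then have "real_of_int i \<le> real_of_int k - 1 \<or> real_of_int k + 2 \<le> real_of_int i"
      by linarith
    then show "tent (s - real_of_int i) = 0"
      using k by (auto simp: tent_def)
  qed auto
  also have "\<dots> = 1"
    using k by (simp add: tent_def max_def)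
  finally show ?thesis .
qed

context quasinilpotent_derivation
begin

text \<open>
  By compactness there is one mesh width for which \<open>\<tau>\<^sub>i(h) D(h)\<close> is small for all tents \<open>\<tau>\<^sub>i\<close> of a
  partition of unity. Tents with even index have disjoint supports, and so have those with odd
  index; by \<open>orthogonal_sandwich\<close> the elements \<open>\<tau>\<^sub>i(h) D(h)\<close> within each of the two classes are
  orthogonal on both sides, so their sum is as small as each of them, regardless of their number.
\<close>

lemma D_selfadjoint:
  assumes h: "star h = h"
  shows "D h = 0"
proof (cases "h = 0")
  case False
  define M where "M = norm h"
  have M: "M > 0"
    using False by (simp add: M_def)
  have "norm (D h) \<le> e" if e0: "e > 0" for e
  proof -
    define e' where "e' = e / 2"
    have e: "e' > 0"
      using e0 by (simp add: e'_def)
    have "\<exists>d>0. \<forall>\<phi>. continuous_on UNIV \<phi> \<longrightarrow> (\<forall>t. \<bar>\<phi> t\<bar> \<le> 1) \<longrightarrow> (\<forall>t. d \<le> \<bar>t - r\<bar> \<longrightarrow> \<phi> t = 0) \<longrightarrow>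
      norm (cfc h \<phi> * D h) \<le> e'" for r
      using D_locally_small[OF h e, of r] by metis
    then obtain d where d: "\<And>r. d r > 0" and small: "\<And>r \<phi>. continuous_on UNIV \<phi> \<Longrightarrow> (\<And>t. \<bar>\<phi> t\<bar> \<le> 1) \<Longrightarrow>
        (\<And>t. d r \<le> \<bar>t - r\<bar> \<Longrightarrow> \<phi> t = 0) \<Longrightarrow> norm (cfc h \<phi> * D h) \<le> e'"
      by metis
    obtain \<eta> where \<eta>: "\<eta> > 0" "\<And>x. x \<in> {- M..M} \<Longrightarrow> \<exists>G \<in> range (\<lambda>r. ball r (d r)). ball x \<eta> \<subseteq> G"
    proof (rule Heine_Borel_lemma[of "{- M..M}" "range (\<lambda>r. ball r (d r))"])
      show "{- M..M} \<subseteq> \<Union> (range (\<lambda>r. ball r (d r)))"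
        using d centre_in_ball by blast
    qed auto
    obtain N where N: "M / \<eta> < real N"
      using reals_Archimedean2 by blast
    then have Npos: "real N > 0"
      using M \<eta>(1) by (meson divide_pos_pos order_less_trans)
    have mesh: "M / real N < \<eta>"
      using N Npos \<eta>(1) by (simp add: field_simps)
    \<comment> \<open>The tent \<open>\<tau> i\<close> has its peak at \<open>i M / N\<close> and vanishes at distance \<open>M / N\<close> from it.\<close>
    define \<tau> where "\<tau> i t = tent (real N / M * t - real_of_int i)" for i t
    have cont: "continuous_on S (\<tau> i)" for S i
      unfolding \<tau>_def tent_def by (intro continuous_intros)
    define w where "w i = cfc h (\<tau> i) * D h" for i
    have w_small: "norm (w i) \<le> e'" if i: "i \<in> {- int N..int N}" for i
    proof -
      define x where "x = real_of_int i * M / real N"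
      have "\<bar>real_of_int i\<bar> \<le> real N"
        using i by auto
      then have "\<bar>x\<bar> \<le> M"
        using M Npos by (simp add: x_def abs_mult divide_simps)
      then have "x \<in> {- M..M}"
        by auto
      then obtain r where r: "ball x \<eta> \<subseteq> ball r (d r)"
        using \<eta>(2) by auto
      show ?thesis
        unfolding w_def
      proof (rule small[of "\<tau> i" r])
        show "\<bar>\<tau> i t\<bar> \<le> 1" for t
          by (simp add: \<tau>_def tent_def)
        fix t assume "d r \<le> \<bar>t - r\<bar>"
        then have "t \<notin> ball r (d r)"
          by (simp add: dist_real_def abs_minus_commute)
        then have "t \<notin> ball x \<eta>"
          using r by blast
        then have "\<eta> \<le> \<bar>t - x\<bar>"
          by (simp add: dist_real_def abs_minus_commute)
        then have "M / real N \<le> \<bar>t - x\<bar>"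
          using mesh by simp
        then have "real N / M * (M / real N) \<le> real N / M * \<bar>t - x\<bar>"
          using M by (intro mult_left_mono) auto
        also have "real N / M * \<bar>t - x\<bar> = \<bar>real N / M * (t - x)\<bar>"
          using M by (simp add: abs_mult)
        also have "real N / M * (t - x) = real N / M * t - real_of_int i"
          using M Npos by (simp add: x_def right_diff_distrib)
        finally show "\<tau> i t = 0"
          using M Npos by (simp add: \<tau>_def tent_def)
      qed (rule cont)
    qed
    have orth: "star (w i) * w j = 0 \<and> w i * star (w j) = 0" if "i \<noteq> j" "even i = even j" for i j
    proof -
      have "i \<le> j - 2 \<or> j \<le> i - 2"
        using that by presburger
      then have "real_of_int i \<le> real_of_int j - 2 \<or> real_of_int j \<le> real_of_int i - 2"
        by linarith
      then have disj: "\<tau> i t * \<tau> j t = 0" "\<tau> j t * \<tau> i t = 0" for t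
        by (auto simp: \<tau>_def tent_def max_def)
      have z: "cfc h (\<tau> i) * cfc h (\<tau> j) = 0" "cfc h (\<tau> j) * cfc h (\<tau> i) = 0"
        unfolding cfc_mult[OF h cont cont, symmetric] disj using cfc_const[OF h, of 0] by simp_all
      have "star (w i) * w j = star (D h) * (cfc h (\<tau> i) * cfc h (\<tau> j)) * D h"
        by (simp only: w_def star_mult cfc_selfadjoint[OF h cont] mult.assoc)
      moreover have "w i * star (w j) = cfc h (\<tau> i) * D h * star (D h) * cfc h (\<tau> j)"
        by (simp only: w_def star_mult cfc_selfadjoint[OF h cont] mult.assoc)
      ultimately show ?thesis
        using z orthogonal_sandwich[OF z(2)] by simp
    qed
    have fin: "finite {i \<in> {- int N..int N}. even i = b}" for b
      by (rule finite_subset[of _ "{- int N..int N}"]) auto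
    have half: "norm (\<Sum>i\<in>{i \<in> {- int N..int N}. even i = b}. w i) \<le> e'" for b
    proof (rule norm_orthogonal_family_le[OF fin e])
      fix i assume "i \<in> {i \<in> {- int N..int N}. even i = b}"
      then show "norm (w i) \<le> e'"
        using w_small by simp
    next
      fix i j assume "i \<in> {i \<in> {- int N..int N}. even i = b}" "j \<in> {i \<in> {- int N..int N}. even i = b}" "i \<noteq> j"
      then show "star (w i) * w j = 0 \<and> w i * star (w j) = 0"
        by (intro orth) simp_all
    qed
    have "(\<Sum>i\<in>{- int N..int N}. cfc h (\<tau> i)) = cfc h (\<lambda>t. \<Sum>i\<in>{- int N..int N}. \<tau> i t)"
      by (rule cfc_sum[OF h _ cont, symmetric]) simp
    also have "\<dots> = cfc h (\<lambda>t. 1)"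
    proof (rule cfc_cong)
      fix t assume "\<bar>t\<bar> \<le> norm h"
      then have "\<bar>real N / M * t\<bar> \<le> real N"
        using M by (simp add: abs_mult M_def divide_simps mult_left_mono)
      then show "(\<Sum>i\<in>{- int N..int N}. \<tau> i t) = 1"
        unfolding \<tau>_def by (rule sum_tent)
    qed
    finally have "(\<Sum>i\<in>{- int N..int N}. cfc h (\<tau> i)) = 1"
      using cfc_const[OF h, of 1] by simp
    then have "D h = (\<Sum>i\<in>{- int N..int N}. w i)"
      by (simp add: w_def flip: sum_distrib_right)
    also have "\<dots> = (\<Sum>i\<in>{i \<in> {- int N..int N}. even i = True}. w i) +
        (\<Sum>i\<in>{i \<in> {- int N..int N}. even i = False}. w i)"
    proof (subst sum.union_disjoint[OF fin fin, symmetric])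
      show "sum w {- int N..int N} =
          sum w ({i \<in> {- int N..int N}. even i = True} \<union> {i \<in> {- int N..int N}. even i = False})"
        by (rule sum.cong) auto
    qed auto
    also have "norm \<dots> \<le> e' + e'"
      by (rule order_trans[OF norm_triangle_ineq add_mono[OF half half]])
    finally have "norm (D h) \<le> e' + e'" .
    then show "norm (D h) \<le> e"
      by (simp add: e'_def)
  qed
  then show ?thesis
    using field_le_epsilon[of "norm (D h)" 0] by simp
qed simp

lemma D_eq_0: "D a = 0"
proof -
  define h where "h = a + star a"
  define k where "k = \<i> *\<^sub>C (a - star a)"
  have "star h = h" "star k = k"
    by (simp_all add: h_def k_def star_add star_diff star_star star_scaleC scaleC_minus_left
        scaleC_diff_right add.commute)
  then have "D h = 0" "D k = 0"
    by (simp_all add: D_selfadjoint)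
  moreover have "2 *\<^sub>R a = h - \<i> *\<^sub>C k"
    by (simp add: h_def k_def scaleC_scaleC scaleC_minus_left scaleR_2)
  ultimately have "2 *\<^sub>R D a = 0"
    by (metis D_diff D_scaleC D_scaleR diff_zero scaleC_0_right)
  then show ?thesis
    by simp
qed

end


section \<open>The unitization\<close>

lemma bounded_linear_scaleC: "bounded_linear (\<lambda>x::'a::cstar_algebra. c *\<^sub>C x)"
  by (rule bounded_linear_intro[where K = "cmod c"])
    (simp_all add: scaleC_add_right scaleR_scaleC scaleC_scaleC norm_scaleC mult.commute)

datatype 'a unitization = Unitization (part: 'a) (scalar: complex)

instantiation unitization :: (cstar_algebra) real_algebra_1
begin

definition "0 = Unitization 0 0"
definition "1 = Unitization 0 1"
definition "x + y = Unitization (part x + part y) (scalar x + scalar y)"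
definition "x - y = Unitization (part x - part y) (scalar x - scalar y)"
definition "- x = Unitization (- part x) (- scalar x)"
definition "r *\<^sub>R x = Unitization (r *\<^sub>R part x) (r *\<^sub>R scalar x)"
definition "x * y =
  Unitization (part x * part y + scalar x *\<^sub>C part y + scalar y *\<^sub>C part x) (scalar x * scalar y)"

lemmas unitization_defs = zero_unitization_def one_unitization_def plus_unitization_def
  minus_unitization_def uminus_unitization_def scaleR_unitization_def times_unitization_def

instance
  by standard
    (simp_all add: unitization_defs unitization.expand algebra_simps scaleC_add_left
      scaleC_add_right scaleC_scaleC scaleR_scaleC mult_scaleC_left mult_scaleC_right
      scaleC_complex_def)

end

lemma part_simps [simp]:
  "part (0::'a::cstar_algebra unitization) = 0" "part (1::'a unitization) = 0"
  "part (x + y) = part x + part (y::'a unitization)" "part (x - y) = part x - part y"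
  "part (- x) = - part x" "part (r *\<^sub>R x) = r *\<^sub>R part x"
  "part (x * y) = part x * part y + scalar x *\<^sub>C part y + scalar y *\<^sub>C part x"
  by (simp_all add: unitization_defs)

lemma scalar_simps [simp]:
  "scalar (0::'a::cstar_algebra unitization) = 0" "scalar (1::'a unitization) = 1"
  "scalar (x + y) = scalar x + scalar (y::'a unitization)" "scalar (x - y) = scalar x - scalar y"
  "scalar (- x) = - scalar x" "scalar (r *\<^sub>R x) = r *\<^sub>R scalar x"
  "scalar (x * y) = scalar x * scalar y"
  by (simp_all add: unitization_defs)

text \<open>
  An element \<open>a + s1\<close> of the unitization acts on the algebra by left multiplication.
\<close>

definition act :: "'a::cstar_algebra unitization \<Rightarrow> 'a \<Rightarrow> 'a" where
  "act x b = part x * b + scalar x *\<^sub>C b"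

lemma bounded_linear_act: "bounded_linear (act x)"
  unfolding act_def by (intro bounded_linear_add bounded_linear_mult_right bounded_linear_scaleC)

lemma act_add: "act (x + y) b = act x b + act y b"
  by (simp add: act_def scaleC_add_left algebra_simps)

lemma act_scaleR: "act (r *\<^sub>R x) b = r *\<^sub>R act x b"
  by (simp add: act_def scaleR_scaleC scaleC_add_right scaleC_scaleC mult_scaleC_left
      scaleC_complex_def)

lemma act_mult: "act (x * y) b = act x (act y b)"
  by (simp add: act_def algebra_simps mult_scaleC_left mult_scaleC_right scaleC_add_right scaleC_scaleC)

lemma act_eq_0_imp:
  assumes "\<And>b. act x b = 0" "scalar x = 0"
  shows "x = 0"
  using assms(1)[of "star (part x)"] assms(2) mult_star_self_eq_0[of "part x"]
  by (simp add: act_def unitization_defs unitization.expand)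

text \<open>
  The operator norm of the action alone is only a seminorm if the algebra has an identity element
  \<open>e\<close>, because \<open>- e + 1\<close> acts as zero. The maximum with the modulus of the scalar part is a
  C*-norm in all cases.
\<close>

instantiation unitization :: (cstar_algebra) real_normed_algebra_1
begin

definition "norm x = max (onorm (act x)) (cmod (scalar x))"
definition "sgn x = inverse (norm x) *\<^sub>R (x::'a unitization)"
definition "dist x y = norm (x - y :: 'a unitization)"
definition
  "(uniformity :: ('a unitization \<times> 'a unitization) filter) =
    (INF e\<in>{0 <..}. principal {(x, y). dist x y < e})"
definition
  "open (U :: 'a unitization set) \<longleftrightarrow>
    (\<forall>x\<in>U. eventually (\<lambda>(x', y). x' = x \<longrightarrow> y \<in> U) uniformity)"

instance
proof
  fix x y :: "'a unitization" and r :: real and U :: "'a unitization set"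
  show "dist x y = norm (x - y)"
    by (simp add: dist_unitization_def)
  show "sgn x = inverse (norm x) *\<^sub>R x"
    by (simp add: sgn_unitization_def)
  show "uniformity = (INF e\<in>{0 <..}. principal {(x, y::'a unitization). dist x y < e})"
    by (simp add: uniformity_unitization_def)
  show "open U \<longleftrightarrow> (\<forall>x\<in>U. eventually (\<lambda>(x', y). x' = x \<longrightarrow> y \<in> U) uniformity)"
    by (simp add: open_unitization_def)
  show "(norm x = 0) = (x = 0)"
  proof
    assume "norm x = 0"
    then have "onorm (act x) = 0" "scalar x = 0"
      using onorm_pos_le[OF bounded_linear_act[of x]] norm_ge_zero[of "scalar x"]
      unfolding norm_unitization_def by (auto simp: max_def split: if_splits)
    then show "x = 0"
      using act_eq_0_imp onorm_eq_0[OF bounded_linear_act[of x]] by blast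
  next
    assume "x = 0"
    then have "act x = (\<lambda>b. 0)"
      by (simp add: act_def fun_eq_iff)
    then show "norm x = 0"
      using \<open>x = 0\<close> by (simp add: norm_unitization_def onorm_zero)
  qed
  show "norm (x + y) \<le> norm x + norm y"
  proof -
    have "onorm (act (x + y)) \<le> onorm (act x) + onorm (act y)"
      using onorm_triangle[OF bounded_linear_act bounded_linear_act, of x y]
      by (simp add: act_add[abs_def])
    moreover have "cmod (scalar (x + y)) \<le> cmod (scalar x) + cmod (scalar y)"
      by (simp add: norm_triangle_ineq)
    ultimately show ?thesis
      unfolding norm_unitization_def by linarith
  qed
  show "norm (r *\<^sub>R x) = \<bar>r\<bar> * norm x"
    using onorm_scaleR[OF bounded_linear_act[of x], of r]
    by (simp add: norm_unitization_def act_scaleR[abs_def] max_mult_distrib_left)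
  show "norm (x * y) \<le> norm x * norm y"
  proof -
    have nonneg: "0 \<le> onorm (act x)" "0 \<le> onorm (act y)"
      using onorm_pos_le[OF bounded_linear_act] by blast+
    have "onorm (act (x * y)) \<le> onorm (act x) * onorm (act y)"
      using onorm_compose[OF bounded_linear_act bounded_linear_act, of x y]
      by (simp add: act_mult[abs_def] o_def)
    also have "\<dots> \<le> norm x * norm y"
      unfolding norm_unitization_def using nonneg by (intro mult_mono) auto
    finally have "onorm (act (x * y)) \<le> norm x * norm y" .
    moreover have "cmod (scalar (x * y)) \<le> norm x * norm y"
      unfolding norm_unitization_def scalar_simps norm_mult using nonneg by (intro mult_mono) auto
    ultimately show ?thesis
      by (simp add: norm_unitization_def[of "x * y"])
  qed
  show "norm (1::'a unitization) = 1"
    using onorm_id_le[where 'a = 'a] by (simp add: norm_unitization_def act_def[abs_def])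
qed

end

lemma norm_act_le: "norm (act x b) \<le> norm x * norm b"
proof -
  have "norm (act x b) \<le> onorm (act x) * norm b"
    by (rule onorm[OF bounded_linear_act])
  also have "\<dots> \<le> norm x * norm b"
    by (intro mult_right_mono) (auto simp: norm_unitization_def)
  finally show ?thesis .
qed

lemma norm_scalar_le: "cmod (scalar x) \<le> norm x"
  by (simp add: norm_unitization_def)

lemma norm_unitization_le:
  assumes "\<And>b. norm (act x b) \<le> K * norm b" "cmod (scalar x) \<le> K"
  shows "norm x \<le> K"
  using onorm_bound[of K "act x"] assms order_trans[OF norm_ge_zero assms(2)]
  by (simp add: norm_unitization_def)

lemma bounded_linear_scalar: "bounded_linear (scalar :: 'a::cstar_algebra unitization \<Rightarrow> complex)"
  by (rule bounded_linear_intro[where K = 1]) (simp_all add: norm_scalar_le)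

lemma norm_part_le: "norm (part x) \<le> norm x * 2"
proof (cases "part x = 0")
  case False
  define b where "b = star (part x)"
  have "part x * b = act x b - scalar x *\<^sub>C b"
    by (simp add: act_def)
  then have "norm (part x * b) \<le> norm (act x b) + norm (scalar x *\<^sub>C b)"
    by (simp add: norm_triangle_ineq4)
  also have "\<dots> \<le> norm x * norm b + norm x * norm b"
    by (intro add_mono norm_act_le) (simp add: norm_scaleC mult_right_mono norm_scalar_le)
  also have "\<dots> = norm x * 2 * norm (part x)"
    by (simp add: b_def)
  finally have "norm (part x) * norm (part x) \<le> norm x * 2 * norm (part x)"
    using cstar_identity[of "star (part x)"] by (simp add: b_def star_star power2_eq_square)
  then show ?thesis
    using False by (simp add: mult_le_cancel_right)
qed simp

lemma bounded_linear_part: "bounded_linear (part :: 'a::cstar_algebra unitization \<Rightarrow> 'a)"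
  by (rule bounded_linear_intro[where K = 2]) (simp_all add: norm_part_le)

lemma bounded_linear_embed: "bounded_linear (\<lambda>a::'a::cstar_algebra. Unitization a 0)"
proof (rule bounded_linear_intro[where K = 1])
  show "norm (Unitization a 0) \<le> norm a * 1" for a :: 'a
    by (rule norm_unitization_le) (simp_all add: act_def norm_mult_ineq)
qed (simp_all add: unitization_defs)

lemma bounded_linear_embed_scalar:
  "bounded_linear (\<lambda>c. Unitization 0 c :: 'a::cstar_algebra unitization)"
proof (rule bounded_linear_intro[where K = 1])
  show "norm (Unitization 0 c :: 'a unitization) \<le> norm c * 1" for c
    by (rule norm_unitization_le) (simp_all add: act_def norm_scaleC)
qed (simp_all add: unitization_defs)

instance unitization :: (cstar_algebra) banach
proof
  fix X :: "nat \<Rightarrow> 'a unitization"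
  assume "Cauchy X"
  then have "convergent (\<lambda>n. part (X n))" "convergent (\<lambda>n. scalar (X n))"
    by (auto intro!: Cauchy_convergent bounded_linear.Cauchy[OF bounded_linear_part]
        bounded_linear.Cauchy[OF bounded_linear_scalar])
  then obtain a c where "(\<lambda>n. part (X n)) \<longlonglongrightarrow> a" "(\<lambda>n. scalar (X n)) \<longlonglongrightarrow> c"
    by (auto simp: convergent_def)
  then have "(\<lambda>n. Unitization (part (X n)) 0 + Unitization 0 (scalar (X n)))
      \<longlonglongrightarrow> Unitization a 0 + Unitization 0 c"
    by (intro tendsto_add bounded_linear.tendsto[OF bounded_linear_embed]
        bounded_linear.tendsto[OF bounded_linear_embed_scalar])
  then show "convergent X"
    unfolding convergent_def by (auto simp: unitization_defs)
qed

instantiation unitization :: (cstar_algebra) cstar_algebra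
begin

definition "c *\<^sub>C x = Unitization (c *\<^sub>C part x) (c * scalar x)"
definition "star x = Unitization (star (part x)) (cnj (scalar x))"

instance
proof
  fix x y :: "'a unitization" and b c :: complex and r :: real
  show "c *\<^sub>C (x + y) = c *\<^sub>C x + c *\<^sub>C y" "(b + c) *\<^sub>C x = b *\<^sub>C x + c *\<^sub>C x"
    "b *\<^sub>C c *\<^sub>C x = (b * c) *\<^sub>C x" "r *\<^sub>R x = complex_of_real r *\<^sub>C x"
    "(c *\<^sub>C x) * y = c *\<^sub>C (x * y)" "x * (c *\<^sub>C y) = c *\<^sub>C (x * y)"
    by (simp_all add: scaleC_unitization_def unitization_defs algebra_simps scaleC_add_left
        scaleC_add_right scaleC_scaleC scaleR_scaleC mult_scaleC_left mult_scaleC_right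
        scaleC_complex_def)
  show "star (x + y) = star x + star y" "star (c *\<^sub>C x) = cnj c *\<^sub>C star x"
    "star (x * y) = star y * star x" "star (star x) = x"
    by (simp_all add: star_unitization_def scaleC_unitization_def unitization_defs star_add
        star_scaleC star_mult star_star algebra_simps)
  have act_scaleC: "act (c *\<^sub>C x) b = c *\<^sub>C act x b" for c and x :: "'a unitization" and b
    by (simp add: act_def scaleC_unitization_def scaleC_add_right scaleC_scaleC mult_scaleC_left)
  have scaleC_le: "norm (c *\<^sub>C x) \<le> cmod c * norm x" for c and x :: "'a unitization"
  proof (rule norm_unitization_le)
    show "norm (act (c *\<^sub>C x) b) \<le> cmod c * norm x * norm b" for b
      by (simp add: act_scaleC norm_scaleC mult.assoc mult_left_mono norm_act_le)
    show "cmod (scalar (c *\<^sub>C x)) \<le> cmod c * norm x"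
      by (simp add: scaleC_unitization_def norm_mult mult_left_mono norm_scalar_le)
  qed
  show "norm (c *\<^sub>C x) = cmod c * norm x"
  proof (cases "c = 0")
    case True
    then have "c *\<^sub>C x = 0"
      by (simp add: scaleC_unitization_def unitization_defs)
    then show ?thesis using True by simp
  next
    case False
    then have "inverse c *\<^sub>C c *\<^sub>C x = x"
      by (simp add: scaleC_unitization_def scaleC_scaleC flip: mult.assoc)
    then have "norm x \<le> cmod (inverse c) * norm (c *\<^sub>C x)"
      using scaleC_le[of "inverse c" "c *\<^sub>C x"] by simp
    then have "cmod c * norm x \<le> norm (c *\<^sub>C x)"
      using False by (simp add: inverse_eq_divide norm_divide pos_le_divide_eq mult.commute)
    then show ?thesis
      using scaleC_le[of c x] by simp
  qed
  have square_le: "(norm x)\<^sup>2 \<le> norm (star x * x)" for x :: "'a unitization"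
  proof -
    have "norm x \<le> sqrt (norm (star x * x))"
    proof (rule norm_unitization_le)
      fix b
      have "star (act x b) * act x b = star b * act (star x * x) b"
        by (simp add: act_mult)
          (simp add: act_def star_unitization_def star_add star_mult star_scaleC algebra_simps
            mult_scaleC_left mult_scaleC_right scaleC_add_right scaleC_scaleC)
      then have "(norm (act x b))\<^sup>2 = norm (star b * act (star x * x) b)"
        by (simp flip: cstar_identity)
      also have "\<dots> \<le> norm b * (norm (star x * x) * norm b)"
        by (intro order_trans[OF norm_mult_ineq] mult_mono norm_act_le) simp_all
      finally have "(norm (act x b))\<^sup>2 \<le> norm (star x * x) * (norm b)\<^sup>2"
        by (simp add: power2_eq_square mult_ac)
      then have "(norm (act x b))\<^sup>2 \<le> (sqrt (norm (star x * x)) * norm b)\<^sup>2"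
        by (simp add: power_mult_distrib)
      then show "norm (act x b) \<le> sqrt (norm (star x * x)) * norm b"
        by (rule power2_le_imp_le) simp
    next
      have "(cmod (scalar x))\<^sup>2 = cmod (scalar (star x * x))"
        by (simp add: star_unitization_def norm_mult power2_eq_square)
      then show "cmod (scalar x) \<le> sqrt (norm (star x * x))"
        using norm_scalar_le[of "star x * x"] by (intro real_le_rsqrt) simp
    qed
    then have "(norm x)\<^sup>2 \<le> (sqrt (norm (star x * x)))\<^sup>2"
      by (intro power_mono) auto
    then show ?thesis
      by simp
  qed
  have norm_le_star: "norm x \<le> norm (star x)" for x :: "'a unitization"
  proof (cases "x = 0")
    case False
    have "norm x * norm x \<le> norm (star x) * norm x"
      using square_le[of x] norm_mult_ineq[of "star x" x] by (simp add: power2_eq_square)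
    then show ?thesis
      using False by (simp add: mult_le_cancel_right)
  qed simp
  have "norm (star x) \<le> norm x"
    using norm_le_star[of "star x"] by (simp add: star_unitization_def star_star)
  then have "norm (star x * x) \<le> norm x * norm x"
    by (intro order_trans[OF norm_mult_ineq] mult_right_mono) auto
  then show "norm (star x * x) = (norm x)\<^sup>2"
    using square_le[of x] by (simp add: power2_eq_square)
qed

end

instance unitization :: (cstar_algebra) unital_cstar_algebra ..


section \<open>Quasinilpotent elements and the unitization\<close>

text \<open>
  The inverse of \<open>c - q\<close> is \<open>1/c + q/c\<^sup>2\<close>. In the zero algebra the spectrum of \<open>0\<close> is empty.
\<close>

lemma square_zero_in_quasinilpotents:
  fixes q :: "'a::cstar_algebra"
  assumes q: "q * q = 0" and nontrivial: "\<exists>x::'a. x \<noteq> 0"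
  shows "q \<in> quasinilpotents"
proof (cases "\<exists>e::'a. is_identity e")
  case True
  then obtain e :: 'a where e: "is_identity e" ..
  then have mult_e: "e * x = x" "x * e = x" for x
    by (auto simp: is_identity_def)
  have unique: "e' = e" if "is_identity e'" for e'
    using that mult_e by (metis is_identity_def)
  have "e \<noteq> 0"
    using nontrivial mult_e(1) by (metis mult_zero_left)
  have "\<not> invertible_wrt (*) e (- q)"
  proof
    assume "invertible_wrt (*) e (- q)"
    then obtain y where "- q * y = e"
      by (auto simp: invertible_wrt_def)
    then have "q * (- q * y) = q"
      by (simp add: mult_e)
    then have "q = 0"
      using q by (simp flip: mult.assoc)
    then show False
      using \<open>- q * y = e\<close> \<open>e \<noteq> 0\<close> by simp
  qed
  moreover have "invertible_wrt (*) e (c *\<^sub>C e - q)" if "c \<noteq> 0" for c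
  proof -
    have "(c *\<^sub>C e - q) * (e + inverse c *\<^sub>C q) = c *\<^sub>C e"
      "(e + inverse c *\<^sub>C q) * (c *\<^sub>C e - q) = c *\<^sub>C e"
      using that q
      by (simp_all add: algebra_simps mult_scaleC_left mult_scaleC_right scaleC_scaleC mult_e
          scaleC_add_right)
    then show ?thesis
      unfolding invertible_wrt_def using that
      by (intro exI[of _ "inverse c *\<^sub>C (e + inverse c *\<^sub>C q)"])
        (simp only: mult_scaleC_left mult_scaleC_right scaleC_scaleC left_inverse scaleC_1 simp_thms)
  qed
  ultimately have "\<not> invertible_wrt (*) e (c *\<^sub>C e - q) \<longleftrightarrow> c = 0" for c
    by (cases "c = 0") auto
  then have "(\<exists>e. is_identity e \<and> \<not> invertible_wrt (*) e (c *\<^sub>C e - q)) \<longleftrightarrow> c = 0" for c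
    using e unique by metis
  then have "alg_spectrum q = {0}"
    using True by (simp add: alg_spectrum_def)
  then show ?thesis
    by (simp add: quasinilpotents_def)
next
  case False
  have "invertible_wrt unitization_mult (0, 1) (- q, c)" if "c \<noteq> 0" for c
    unfolding invertible_wrt_def unitization_mult_def
    using that q
    by (intro exI[of _ "((inverse c * inverse c) *\<^sub>C q, inverse c)"])
      (simp add: mult_scaleC_right mult_scaleC_left scaleC_scaleC scaleC_minus_right flip: mult.assoc)
  moreover have "\<not> invertible_wrt unitization_mult (0, 1) (- q, 0)"
    by (simp add: invertible_wrt_def unitization_mult_def)
  ultimately have "\<not> invertible_wrt unitization_mult (0, 1) (- q, c) \<longleftrightarrow> c = 0" for c
    by (cases "c = 0") auto
  then show ?thesis
    using False by (simp add: quasinilpotents_def alg_spectrum_def)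
qed

text \<open>
  If the algebra has an identity element \<open>e\<close> and \<open>y\<close> is the inverse of \<open>c e - q\<close> in it, then the
  inverse of \<open>c 1 - q\<close> in the unitization is \<open>(y - e/c) + 1/c\<close>, because the unitization has the
  additional central idempotent \<open>1 - e\<close>.
\<close>

lemma quasinilpotent_invertible:
  fixes q :: "'a::cstar_algebra"
  assumes q: "q \<in> quasinilpotents" and c: "c \<noteq> 0"
  shows "invertible_wrt (*) 1 (Unitization (- q) c)"
proof (cases "\<exists>e::'a. is_identity e")
  case True
  then obtain e :: 'a where e: "is_identity e" ..
  then have mult_e: "e * x = x" "x * e = x" for x
    by (auto simp: is_identity_def)
  have "c \<notin> alg_spectrum q"
    using q c by (simp add: quasinilpotents_def)
  then have "invertible_wrt (*) e (c *\<^sub>C e - q)"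
    using True e unfolding alg_spectrum_def by auto
  then obtain y where y: "(c *\<^sub>C e - q) * y = e" "y * (c *\<^sub>C e - q) = e"
    by (auto simp: invertible_wrt_def)
  then have "c *\<^sub>C y - q * y = e" "c *\<^sub>C y - y * q = e"
    by (simp_all add: left_diff_distrib right_diff_distrib mult_scaleC_left mult_scaleC_right mult_e)
  then have "q * y = c *\<^sub>C y - e" "y * q = c *\<^sub>C y - e"
    by (simp_all add: algebra_simps)
  then show ?thesis
    using c
    by (intro invertible_if_left_right[of "Unitization (y - inverse c *\<^sub>C e) (inverse c)" _
          "Unitization (y - inverse c *\<^sub>C e) (inverse c)"])
      (simp_all add: times_unitization_def one_unitization_def algebra_simps scaleC_diff_right
        scaleC_scaleC mult_scaleC_left mult_scaleC_right mult_e scaleC_minus_right)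
next
  case False
  then have "invertible_wrt unitization_mult (0, 1) (- q, c)"
    using q c by (auto simp: quasinilpotents_def alg_spectrum_def)
  then obtain y where "unitization_mult (- q, c) y = (0, 1)" "unitization_mult y (- q, c) = (0, 1)"
    by (auto simp: invertible_wrt_def)
  then show ?thesis
    by (intro invertible_if_left_right[of "Unitization (fst y) (snd y)" _ "Unitization (fst y) (snd y)"])
      (simp_all add: times_unitization_def one_unitization_def unitization_mult_def)
qed

theorem corollary4p3:
  fixes d :: "'a::cstar_algebra \<Rightarrow> 'a"
  assumes "derivation d"
    and "d ` quasinilpotents \<subseteq> quasinilpotents"
  shows "d = (\<lambda>x. 0)"
proof (cases "\<exists>x::'a. x \<noteq> 0")
  case False
  then show ?thesis
    by auto
next
  case nontrivial: True
  have lin: "Vector_Spaces.linear scaleC scaleC d" and mult: "d (x * y) = d x * y + x * d y" for x y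
    using assms(1) by (auto simp: derivation_def)
  have add: "d (x + y) = d x + d y" and scale: "d (c *\<^sub>C x) = c *\<^sub>C d x" for x y c
    using lin by (auto simp: Vector_Spaces.linear_iff)
  define D where "D x = Unitization (d (part x)) 0" for x
  interpret quasinilpotent_derivation D
  proof
    fix x y :: "'a unitization" and c :: complex
    show "D (x + y) = D x + D y" "D (c *\<^sub>C x) = c *\<^sub>C D x"
      by (simp_all add: D_def add scale plus_unitization_def scaleC_unitization_def)
    show "D (x * y) = D x * y + x * D y"
      by (simp add: D_def plus_unitization_def times_unitization_def add scale mult)
    assume "x * x = 0" "c \<noteq> 0"
    then have "scalar x = 0" "part x * part x = 0"
      by (auto simp: zero_unitization_def times_unitization_def)
    then have "d (part x) \<in> quasinilpotents"
      using assms(2) square_zero_in_quasinilpotents nontrivial by blast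
    then have "invertible_wrt (*) 1 (Unitization (- d (part x)) c)"
      using \<open>c \<noteq> 0\<close> by (rule quasinilpotent_invertible)
    then show "invertible_wrt (*) 1 (c *\<^sub>C 1 - D x)"
      by (simp add: D_def scaleC_unitization_def one_unitization_def minus_unitization_def)
  qed
  have "d x = 0" for x
    using D_eq_0[of "Unitization x 0"] by (simp add: D_def zero_unitization_def)
  then show ?thesis
    by auto
qed

end
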